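(* Let $n \ge 1$ and let $\mathcal{B}$ be a non-degenerate deformation of the type $B_n$ Coxeter arrangement in $\mathbb{R}^n$, i.e. \[\begin{aligned} \mathcal{B} = & \{x_i = a_i^{(1)},\ldots,a_i^{(r_i)} \ |\ 1 \le i \le n\} \cup \{x_i-x_j = b_{ij}^{(1)},\ldots,b_{ij}^{(s_{ij})}\ |\ 1\le i \ne j \le n\} \\ & \cup \{x_i+x_j = c_{ij}^{(1)},\ldots,c_{ij}^{(t_{ij})}\ |\ 1\le i \ne j \le n\}, \end{aligned}\] where all $a_i^{(\cdot)}, b_{ij}^{(\cdot)}, c_{ij}^{(\cdot)} \in \mathbb{R}$ and $r_i, s_{ij}, t_{ij} \ge 1$ for all indices. Then \[\chi_{\mathcal{B}}(t) = \sum_{k = 0}^{n} (-1)^{n-k}\cdot r_k(\mathcal{B}) \cdot \binom{\frac{t-1}{2}}{k},\] where $r_k(\mathcal{B})$ is the number of regions of $\mathcal{B}$ of level $k$.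
   Context: A hyperplane arrangement is a finite set of affine hyperplanes in $\mathbb{R}^n$. Its intersection poset $L(\mathcal{B})$ is the set of all nonempty intersections of hyperplanes of $\mathcal{B}$ (including $\mathbb{R}^n$ itself), ordered by reverse inclusion. The characteristic polynomial is $\chi_{\mathcal{B}}(t) = \sum_{x \in L(\mathcal{B})} \mu(\hat{0},x)\, t^{\dim x}$, where $\mu$ is the Möbius function of $L(\mathcal{B})$ and $\hat 0 = \mathbb{R}^n$. "Non-degenerate" means that in every direction $x_i$, $x_i - x_j$, $x_i + x_j$ ($i\neq j$) there is at least one hyperplane of $\mathcal{B}$. A region is a connected component of the complement of the union of the hyperplanes. The level of a subset $X \subset \mathbb{R}^n$ is the smallest non-negative integer $\ell$ such that $X \subset \{x \in \mathbb{R}^n : d(x,W) \le r\}$ for some linear subspace $W$ of dimension $\ell$ and some real $r>0$. Here $\binom{s}{k} = s(s-1)\cdots(s-k+1)/k!$ as a polynomial, evaluated at $s=(t-1)/2$. *)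

theory Defs
  imports "HOL-Analysis.Analysis"
begin

definition typeB_hyperplane :: "(real^'n) set \<Rightarrow> bool" where
  "typeB_hyperplane H \<longleftrightarrow>
     (\<exists>i a. H = {x. x$i = a}) \<or>
     (\<exists>i j b. i \<noteq> j \<and> H = {x. x$i - x$j = b}) \<or>
     (\<exists>i j c. i \<noteq> j \<and> H = {x. x$i + x$j = c})"

definition nondeg_B_deformation :: "(real^'n) set set \<Rightarrow> bool" where
  "nondeg_B_deformation B \<longleftrightarrow>
     finite B \<and> (\<forall>H\<in>B. typeB_hyperplane H) \<and>
     (\<forall>i. \<exists>a. {x. x$i = a} \<in> B) \<and>
     (\<forall>i j. i \<noteq> j \<longrightarrow> (\<exists>b. {x. x$i - x$j = b} \<in> B)) \<and>
     (\<forall>i j. i \<noteq> j \<longrightarrow> (\<exists>c. {x. x$i + x$j = c} \<in> B))"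

text \<open>Intersection poset: nonempty intersections of subfamilies (the empty
  subfamily gives the whole space), ordered by reverse inclusion.\<close>

definition intersection_poset :: "'a set set \<Rightarrow> 'a set set" where
  "intersection_poset B = {\<Inter>S | S. S \<subseteq> B \<and> \<Inter>S \<noteq> {}}"

definition arr_mobius :: "'a set set \<Rightarrow> 'a set \<Rightarrow> real" where
  "arr_mobius B = (THE f.
      f UNIV = 1 \<and>
      (\<forall>X\<in>intersection_poset B. X \<noteq> UNIV \<longrightarrow>
          f X = - (\<Sum>Y\<in>{Y\<in>intersection_poset B. X \<subset> Y}. f Y)) \<and>
      (\<forall>X. X \<notin> intersection_poset B \<longrightarrow> f X = 0))"

definition char_poly :: "(real^'n) set set \<Rightarrow> real \<Rightarrow> real" where
  "char_poly B t = (\<Sum>X\<in>intersection_poset B. arr_mobius B X * t ^ nat (aff_dim X))"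

definition regions :: "(real^'n) set set \<Rightarrow> (real^'n) set set" where
  "regions B = components (UNIV - \<Union>B)"

definition level :: "(real^'n) set \<Rightarrow> nat" where
  "level X = (LEAST l. \<exists>W r. subspace W \<and> dim W = l \<and> r > 0 \<and>
                         X \<subseteq> {x. infdist x W \<le> r})"

end

theory Submission
  imports Defs "HOL-Computational_Algebra.Polynomial"
begin

text \<open>
  For a vector \<open>v\<close> and a relatively open convex set \<open>P\<close> put
  \<open>psi v P = (-1) ^ (dim P - dim C)\<close> if \<open>v\<close> lies in the relative interior of the recession
  cone \<open>C\<close> of \<open>P\<close>, and \<open>psi v P = 0\<close> otherwise. This is additive under cutting \<open>P\<close> by a
  hyperplane, so by Moebius inversion the sum of \<open>\<mu>(X) psi v X\<close> over all flats \<open>X\<close> equals the sum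
  of \<open>psi v R\<close> over all regions \<open>R\<close>; for a flat, \<open>psi v X\<close> merely records whether \<open>v\<close> is parallel
  to \<open>X\<close>.

  Now sum over all integer vectors \<open>v\<close> with entries in \<open>{-m..m}\<close>. The direction space of a flat
  \<open>X\<close> contains \<open>(2m+1) ^ dim X\<close> of them, which gives the characteristic polynomial at
  \<open>2m+1\<close>. By non-degeneracy the relative interior of the recession cone of a region \<open>R\<close> is a cell
  of the Coxeter arrangement; it is given by fixing the signs and the order of the absolute values of
  the coordinates, so a cell of dimension \<open>k\<close> contains \<open>m choose k\<close> of the vectors, and \<open>k\<close> is the
  level of \<open>R\<close>. Hence both sides agree at all odd \<open>t = 2m+1\<close>, and they are polynomials in \<open>t\<close>.
\<close>

section \<open>Recession cones and a valuation\<close>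

lemma rel_open_Int:
  fixes S :: "'a::euclidean_space set"
  assumes "convex S" "rel_open S" "convex T" "rel_open T"
  shows "convex (S \<inter> T)" "rel_open (S \<inter> T)"
  using convex_rel_open_finite_Inter[of "{S, T}"] assms by auto

lemma open_imp_rel_open: "open S \<Longrightarrow> rel_open S" for S :: "'a::euclidean_space set"
  by (simp add: rel_open_def rel_interior_open)

lemma rel_open_cut_gt:
  fixes S :: "'a::euclidean_space set"
  assumes "convex S" "rel_open S"
  shows "convex (S \<inter> {x. a \<bullet> x > b})" "rel_open (S \<inter> {x. a \<bullet> x > b})"
  using rel_open_Int[OF assms, of "{x. a \<bullet> x > b}"]
  by (simp_all add: convex_halfspace_gt open_imp_rel_open open_halfspace_gt)

lemma rel_open_cut_lt:
  fixes S :: "'a::euclidean_space set"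
  assumes "convex S" "rel_open S"
  shows "convex (S \<inter> {x. a \<bullet> x < b})" "rel_open (S \<inter> {x. a \<bullet> x < b})"
  using rel_open_Int[OF assms, of "{x. a \<bullet> x < b}"]
  by (simp_all add: convex_halfspace_lt open_imp_rel_open open_halfspace_lt)

lemma rel_open_cut_eq:
  fixes S :: "'a::euclidean_space set"
  assumes "convex S" "rel_open S"
  shows "convex (S \<inter> {x. a \<bullet> x = b})" "rel_open (S \<inter> {x. a \<bullet> x = b})"
  using rel_open_Int[OF assms, of "{x. a \<bullet> x = b}"]
  by (simp_all add: convex_hyperplane affine_rel_open affine_hyperplane)

lemma rel_open_extend:
  fixes S :: "'a::euclidean_space set"
  assumes "convex S" "rel_open S" "x \<in> S" "y \<in> S"
  obtains e where "e > 1" "(1 - e) *\<^sub>R x + e *\<^sub>R y \<in> S"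
  using assms convex_rel_interior_iff[of S y] by (auto simp: rel_open_def)

text \<open>A nonempty set that is open in the affine hull of \<open>S\<close> has the dimension of
  that hull.\<close>

lemma aff_dim_cut_gt:
  fixes S :: "'a::euclidean_space set"
  assumes "rel_open S" "S \<inter> {x. a \<bullet> x > b} \<noteq> {}"
  shows "aff_dim (S \<inter> {x. a \<bullet> x > b}) = aff_dim S"
proof -
  have "openin (top_of_set (affine hull S)) (S \<inter> {x. a \<bullet> x > b})"
    using assms(1) by (intro openin_Int_open) (auto simp: rel_open open_halfspace_gt)
  from aff_dim_openin[OF this] assms(2) show ?thesis by simp
qed

text \<open>The slice is open in the section of the affine hull of \<open>S\<close> by the
  hyperplane, and the point \<open>y\<close> off the hyperplane makes this section one dimension
  smaller than the hull.\<close>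

lemma aff_dim_cut_eq:
  fixes S :: "'a::euclidean_space set"
  assumes "rel_open S" "S \<inter> {x. a \<bullet> x = b} \<noteq> {}" "y \<in> S" "a \<bullet> y \<noteq> b"
  shows "aff_dim (S \<inter> {x. a \<bullet> x = b}) = aff_dim S - 1"
proof -
  let ?H = "{x. a \<bullet> x = b}"
  have "openin (top_of_set (affine hull S)) S"
    using assms(1) by (simp add: rel_open)
  then obtain U where U: "open U" "S = affine hull S \<inter> U"
    by (auto simp: openin_open)
  have "S \<inter> ?H = (affine hull S \<inter> ?H) \<inter> U" using U by blast
  then have "openin (top_of_set (affine hull S \<inter> ?H)) (S \<inter> ?H)"
    using U(1) by (metis openin_open)
  then have "aff_dim (S \<inter> ?H) = aff_dim (affine hull S \<inter> ?H)"
    by (rule aff_dim_openin) (use assms(2) in \<open>auto intro!: affine_Int affine_hyperplane\<close>)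
  moreover have "affine hull S \<inter> ?H \<noteq> {}"
    using assms(2) hull_subset[of S affine] by blast
  moreover have "\<not> affine hull S \<subseteq> ?H"
    using assms(3,4) hull_subset[of S affine] by blast
  ultimately show ?thesis
    by (simp add: aff_dim_affine_Int_hyperplane)
qed

section \<open>Recession cones\<close>

definition rec_cone :: "'a::real_vector set \<Rightarrow> 'a set" where
  "rec_cone P = {u. \<forall>x\<in>P. \<forall>t\<ge>0. x + t *\<^sub>R u \<in> P}"

lemma zero_in_rec_cone [simp]: "0 \<in> rec_cone P"
  by (simp add: rec_cone_def)

lemma convex_rec_cone:
  assumes "convex P" shows "convex (rec_cone P)"
proof (rule convexI)
  fix u w :: 'a and p q :: real
  assume u: "u \<in> rec_cone P" and w: "w \<in> rec_cone P" and pq: "p \<ge> 0" "q \<ge> 0" "p + q = 1"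
  show "p *\<^sub>R u + q *\<^sub>R w \<in> rec_cone P"
    unfolding rec_cone_def
  proof safe
    fix x and t :: real assume "x \<in> P" "0 \<le> t"
    then have "x + t *\<^sub>R u \<in> P" "x + t *\<^sub>R w \<in> P"
      using u w by (auto simp: rec_cone_def)
    then have "p *\<^sub>R (x + t *\<^sub>R u) + q *\<^sub>R (x + t *\<^sub>R w) \<in> P"
      using assms pq by (auto dest: convexD)
    also have "p *\<^sub>R (x + t *\<^sub>R u) + q *\<^sub>R (x + t *\<^sub>R w) =
        (p + q) *\<^sub>R x + t *\<^sub>R (p *\<^sub>R u + q *\<^sub>R w)"
      by (simp add: algebra_simps)
    finally show "x + t *\<^sub>R (p *\<^sub>R u + q *\<^sub>R w) \<in> P" using pq by simp
  qed
qed

text \<open>A single ray suffices: every point of a relatively open convex set lies strictly between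
  the base point of the ray and another point of the set.\<close>

lemma rec_cone_rayI:
  fixes P :: "'a::euclidean_space set"
  assumes "convex P" "rel_open P" "x \<in> P" and ray: "\<And>t. t \<ge> 0 \<Longrightarrow> x + t *\<^sub>R u \<in> P"
  shows "u \<in> rec_cone P"
  unfolding rec_cone_def
proof safe
  fix y and t :: real assume y: "y \<in> P" and t: "0 \<le> t"
  obtain e where e: "e > 1" "(1 - e) *\<^sub>R x + e *\<^sub>R y \<in> P"
    using rel_open_extend[OF assms(1,2,3) y] by blast
  define s where "s = t / (1 - 1/e)"
  have "s \<ge> 0" using e t by (simp add: s_def)
  then have "(1/e) *\<^sub>R ((1 - e) *\<^sub>R x + e *\<^sub>R y) + (1 - 1/e) *\<^sub>R (x + s *\<^sub>R u) \<in> P"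
    using e by (intro convexD[OF assms(1) e(2) ray]) auto
  also have "(1/e) *\<^sub>R ((1 - e) *\<^sub>R x + e *\<^sub>R y) + (1 - 1/e) *\<^sub>R (x + s *\<^sub>R u)
      = ((1/e) * (1 - e) + (1 - 1/e)) *\<^sub>R x + ((1/e) * e) *\<^sub>R y + ((1 - 1/e) * s) *\<^sub>R u"
    by (simp only: scaleR_add_left scaleR_add_right scaleR_scaleR) (simp add: algebra_simps)
  also have "\<dots> = y + t *\<^sub>R u"
    using e by (simp add: s_def field_simps)
  finally show "y + t *\<^sub>R u \<in> P" .
qed

text \<open>A ray that stays in an open half-space may run parallel to its boundary, so the strict
  inequality on points becomes a weak one on directions. \<open>rec_cone_rayI\<close> passes from
  one ray to the whole of \<open>P\<close>.\<close>

lemma rec_cone_cut_gt: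
  fixes P :: "'a::euclidean_space set"
  assumes "convex P" "rel_open P" "P \<inter> {x. a \<bullet> x > b} \<noteq> {}"
  shows "rec_cone (P \<inter> {x. a \<bullet> x > b}) = rec_cone P \<inter> {u. a \<bullet> u \<ge> 0}"
proof (intro set_eqI iffI)
  fix u assume u: "u \<in> rec_cone (P \<inter> {x. a \<bullet> x > b})"
  obtain x where x: "x \<in> P" "a \<bullet> x > b" using assms(3) by blast
  have ray: "x + t *\<^sub>R u \<in> P" "a \<bullet> x + t * (a \<bullet> u) > b" if "t \<ge> 0" for t
    using u x that by (auto simp: rec_cone_def inner_simps)
  have "a \<bullet> u \<ge> 0"
  proof (rule ccontr)
    assume neg: "\<not> a \<bullet> u \<ge> 0"
    \<comment> \<open>At this parameter the ray reaches the hyperplane, which the open half-space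
      excludes.\<close>
    define t where "t = (b - a \<bullet> x) / (a \<bullet> u)"
    have "t \<ge> 0" using neg x by (simp add: t_def divide_nonpos_neg)
    from ray(2)[OF this] show False using neg by (simp add: t_def)
  qed
  then show "u \<in> rec_cone P \<inter> {u. a \<bullet> u \<ge> 0}"
    using rec_cone_rayI[OF assms(1,2) x(1) ray(1)] by auto
next
  fix u assume "u \<in> rec_cone P \<inter> {u. a \<bullet> u \<ge> 0}"
  then show "u \<in> rec_cone (P \<inter> {x. a \<bullet> x > b})"
    by (auto simp: rec_cone_def inner_simps intro: add_pos_nonneg add_strict_increasing2
        order_less_le_trans)
qed

lemma rec_cone_cut_eq:
  fixes P :: "'a::euclidean_space set"
  assumes "convex P" "rel_open P" "P \<inter> {x. a \<bullet> x = b} \<noteq> {}"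
  shows "rec_cone (P \<inter> {x. a \<bullet> x = b}) = rec_cone P \<inter> {u. a \<bullet> u = 0}"
proof (intro set_eqI iffI)
  fix u assume u: "u \<in> rec_cone (P \<inter> {x. a \<bullet> x = b})"
  obtain x where x: "x \<in> P" "a \<bullet> x = b" using assms(3) by blast
  have ray: "x + t *\<^sub>R u \<in> P" "a \<bullet> x + t * (a \<bullet> u) = b" if "t \<ge> 0" for t
    using u x that by (auto simp: rec_cone_def inner_simps)
  show "u \<in> rec_cone P \<inter> {u. a \<bullet> u = 0}"
    using rec_cone_rayI[OF assms(1,2) x(1) ray(1)] ray(2)[of 1] x by auto
qed (auto simp: rec_cone_def inner_simps)

text \<open>Moving \<open>c\<close> slightly towards a relative interior point puts it into the
  relative interior, while the strict inequality survives a small enough move.\<close>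

lemma rel_interior_meets_gt:
  fixes C :: "'a::euclidean_space set"
  assumes "convex C" "c \<in> C" "a \<bullet> c > b"
  shows "rel_interior C \<inter> {u. a \<bullet> u > b} \<noteq> {}"
proof -
  obtain r where r: "r \<in> rel_interior C" using assms rel_interior_eq_empty by blast
  \<comment> \<open>\<open>K\<close> bounds both the slack of \<open>c\<close> and the rate at which
    the move consumes it, so the step \<open>e\<close> below is at most 1/2 and uses at most half of
    the slack.\<close>
  define K where "K = a \<bullet> c - b + \<bar>a \<bullet> (c - r)\<bar>"
  have K: "K > 0" "a \<bullet> c - b \<le> K" "a \<bullet> (c - r) \<le> K" using assms(3) by (auto simp: K_def)
  define e where "e = (a \<bullet> c - b) / (2 * K)"
  have e: "0 < e" "e \<le> 1" using assms(3) K by (auto simp: e_def field_simps)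
  have "e * (a \<bullet> (c - r)) \<le> e * K"
    using e K by (intro mult_left_mono) auto
  also have "\<dots> = (a \<bullet> c - b) / 2"
    using K by (simp add: e_def)
  also have "\<dots> < a \<bullet> c - b" using assms(3) by simp
  finally have "a \<bullet> (c - e *\<^sub>R (c - r)) > b" by (simp add: inner_simps)
  then show ?thesis
    using rel_interior_convex_shrink[OF assms(1) r assms(2) e] by blast
qed

lemma rel_interior_halfspace_cut:
  fixes C :: "'a::euclidean_space set"
  assumes "convex C" "c \<in> C" "a \<bullet> c > b"
  shows "rel_interior (C \<inter> {u. a \<bullet> u \<ge> b}) = rel_interior C \<inter> {u. a \<bullet> u > b}"
    and "aff_dim (C \<inter> {u. a \<bullet> u \<ge> b}) = aff_dim C"
proof -
  have meet: "rel_interior C \<inter> {u. a \<bullet> u > b} \<noteq> {}"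
    by (rule rel_interior_meets_gt[OF assms])
  have half: "rel_interior {u. a \<bullet> u \<ge> b} = {u. a \<bullet> u > b}"
  proof (cases "a = 0")
    case True
    then show ?thesis using assms(3) by simp
  next
    case False
    then have "interior {u. a \<bullet> u \<ge> b} = {u. a \<bullet> u > b}"
      by (rule interior_halfspace_ge)
    moreover have "{u. a \<bullet> u > b} \<noteq> {}" using assms(3) by blast
    ultimately show ?thesis by (simp add: rel_interior_nonempty_interior)
  qed
  show ri: "rel_interior (C \<inter> {u. a \<bullet> u \<ge> b}) = rel_interior C \<inter> {u. a \<bullet> u > b}"
    using convex_rel_interior_inter_two[OF assms(1) convex_halfspace_ge[of b a]] half meet by auto
  have "aff_dim (rel_interior (C \<inter> {u. a \<bullet> u \<ge> b})) = aff_dim (rel_interior C)"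
    unfolding ri using meet
    by (intro aff_dim_cut_gt) (auto simp: rel_interior_rel_open assms(1))
  then show "aff_dim (C \<inter> {u. a \<bullet> u \<ge> b}) = aff_dim C"
    by (simp add: rel_interior_aff_dim assms(1) convex_Int convex_halfspace_ge)
qed

text \<open>Since \<open>C\<close> has points strictly on both sides, so has its relative interior,
  which is connected and therefore meets the hyperplane. This lets the relative interior commute
  with the section.\<close>

lemma rel_interior_hyperplane_cut:
  fixes C :: "'a::euclidean_space set"
  assumes "convex C" "c \<in> C" "a \<bullet> c > b" "d \<in> C" "a \<bullet> d < b"
  shows "rel_interior (C \<inter> {u. a \<bullet> u = b}) = rel_interior C \<inter> {u. a \<bullet> u = b}"
    and "aff_dim (C \<inter> {u. a \<bullet> u = b}) = aff_dim C - 1"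
proof -
  obtain x where x: "x \<in> rel_interior C" "a \<bullet> x > b"
    using rel_interior_meets_gt[OF assms(1-3)] by blast
  obtain y where y: "y \<in> rel_interior C" "a \<bullet> y < b"
    using rel_interior_meets_gt[OF assms(1,4), of "-b" "-a"] assms(5) by auto
  have "\<exists>z\<in>rel_interior C. a \<bullet> z = b"
    using connected_ivt_hyperplane[OF convex_connected[OF convex_rel_interior[OF assms(1)]] y(1) x(1)]
      x y by force
  then have meet: "rel_interior C \<inter> {u. a \<bullet> u = b} \<noteq> {}" by blast
  show ri: "rel_interior (C \<inter> {u. a \<bullet> u = b}) = rel_interior C \<inter> {u. a \<bullet> u = b}"
    by (rule convex_affine_rel_interior_Int[OF assms(1) affine_hyperplane meet])
  have "aff_dim (rel_interior (C \<inter> {u. a \<bullet> u = b})) = aff_dim (rel_interior C) - 1"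
    unfolding ri using meet x
    by (intro aff_dim_cut_eq) (auto simp: rel_interior_rel_open assms(1))
  then show "aff_dim (C \<inter> {u. a \<bullet> u = b}) = aff_dim C - 1"
    by (simp add: rel_interior_aff_dim assms(1) convex_Int convex_hyperplane)
qed

text \<open>The emptiness test matters, because \<open>rec_cone {}\<close> is the whole space.
  Affine dimensions are integers, whence \<open>powi\<close>; only the parity of the exponent
  counts.\<close>

definition psi :: "'a::euclidean_space \<Rightarrow> 'a set \<Rightarrow> real" where
  "psi v P = (if P \<noteq> {} \<and> v \<in> rel_interior (rec_cone P)
     then (-1) powi (aff_dim P - aff_dim (rec_cone P)) else 0)"

lemma psi_empty [simp]: "psi v {} = 0"
  by (simp add: psi_def)

lemma neg_one_powi_pred: "(-1 :: real) powi (k - 1) = - ((-1) powi k)"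
  by (simp add: power_int_diff)

text \<open>The outer pieces keep the dimension of \<open>P\<close> and the slice loses one; the
  rest depends on the linear form \<open>a\<close> on the recession cone. The hypothesis
  \<open>le\<close> excludes only a form that is nonpositive but not identically zero there, the
  mirror image of case \<open>pos\<close>.\<close>

lemma psi_cut_aux:
  fixes P :: "'a::euclidean_space set"
  assumes P: "convex P" "rel_open P"
    and ne: "x \<in> P" "a \<bullet> x > b" "y \<in> P" "a \<bullet> y < b"
    and le: "\<exists>u\<in>rec_cone P. a \<bullet> u > 0 \<or> (\<forall>u\<in>rec_cone P. a \<bullet> u = 0)"
  shows "psi v P = psi v (P \<inter> {x. a \<bullet> x < b}) + psi v (P \<inter> {x. a \<bullet> x = b})
    + psi v (P \<inter> {x. a \<bullet> x > b})"
proof -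
  obtain z where z: "z \<in> P" "a \<bullet> z = b"
    using connected_ivt_hyperplane[OF convex_connected[OF P(1)] ne(3,1), of a b] ne by auto
  let ?C = "rec_cone P"
  have C: "convex ?C" by (rule convex_rec_cone[OF P(1)])
  have ne1: "P \<inter> {x. a \<bullet> x > b} \<noteq> {}" and ne2: "P \<inter> {x. a \<bullet> x = b} \<noteq> {}"
    and ne3: "P \<inter> {x. a \<bullet> x < b} \<noteq> {}" and neP: "P \<noteq> {}"
    using ne z by auto
  have ne3': "P \<inter> {x. (-a) \<bullet> x > -b} \<noteq> {}"
    using ne3 by simp
  have rec1: "rec_cone (P \<inter> {x. a \<bullet> x > b}) = ?C \<inter> {u. a \<bullet> u \<ge> 0}"
    by (rule rec_cone_cut_gt[OF P ne1])
  have rec2: "rec_cone (P \<inter> {x. a \<bullet> x = b}) = ?C \<inter> {u. a \<bullet> u = 0}"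
    by (rule rec_cone_cut_eq[OF P ne2])
  have rec3: "rec_cone (P \<inter> {x. a \<bullet> x < b}) = ?C \<inter> {u. a \<bullet> u \<le> 0}"
    using rec_cone_cut_gt[OF P ne3'] by simp
  have dim1: "aff_dim (P \<inter> {x. a \<bullet> x > b}) = aff_dim P"
    by (rule aff_dim_cut_gt[OF P(2) ne1])
  have dim2: "aff_dim (P \<inter> {x. a \<bullet> x = b}) = aff_dim P - 1"
    using aff_dim_cut_eq[OF P(2) ne2 ne(1)] ne(2) by simp
  have dim3: "aff_dim (P \<inter> {x. a \<bullet> x < b}) = aff_dim P"
    using aff_dim_cut_gt[OF P(2) ne3'] by simp
  consider (flat) "\<forall>u\<in>?C. a \<bullet> u = 0"
    | (both) c d where "c \<in> ?C" "a \<bullet> c > 0" "d \<in> ?C" "a \<bullet> d < 0"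
    | (pos) c where "c \<in> ?C" "a \<bullet> c > 0" "\<forall>u\<in>?C. a \<bullet> u \<ge> 0"
    using le by (metis linorder_not_less)
  then show ?thesis
  proof cases
    \<comment> \<open>All pieces share the cone of \<open>P\<close>, so their signs are s, -s, s and
      add up to s.\<close>
    case flat
    then have *: "?C \<inter> {u. a \<bullet> u \<ge> 0} = ?C" "?C \<inter> {u. a \<bullet> u = 0} = ?C" "?C \<inter> {u. a \<bullet> u \<le> 0} = ?C"
      by auto
    have "(-1::real) powi (aff_dim P - 1 - aff_dim ?C) = - ((-1) powi (aff_dim P - aff_dim ?C))"
      using neg_one_powi_pred[of "aff_dim P - aff_dim ?C"] by (simp add: algebra_simps)
    then show ?thesis
      unfolding psi_def rec1 rec2 rec3 dim1 dim2 dim3 * using ne1 ne2 ne3 neP by simp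
  next
    \<comment> \<open>The slice and its cone each lose one dimension, so every piece has the sign of
      \<open>P\<close>, and a relative interior \<open>v\<close> of the cone lies in exactly one of
      the three parts.\<close>
    case both
    have ri1: "rel_interior (?C \<inter> {u. a \<bullet> u \<ge> 0}) = rel_interior ?C \<inter> {u. a \<bullet> u > 0}"
        "aff_dim (?C \<inter> {u. a \<bullet> u \<ge> 0}) = aff_dim ?C"
      using rel_interior_halfspace_cut[OF C both(1,2)] by auto
    have ri3: "rel_interior (?C \<inter> {u. a \<bullet> u \<le> 0}) = rel_interior ?C \<inter> {u. a \<bullet> u < 0}"
        "aff_dim (?C \<inter> {u. a \<bullet> u \<le> 0}) = aff_dim ?C"
      using rel_interior_halfspace_cut[OF C both(3), of 0 "-a"] both by auto
    have ri2: "rel_interior (?C \<inter> {u. a \<bullet> u = 0}) = rel_interior ?C \<inter> {u. a \<bullet> u = 0}"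
        "aff_dim (?C \<inter> {u. a \<bullet> u = 0}) = aff_dim ?C - 1"
      using rel_interior_hyperplane_cut[OF C both] by auto
    show ?thesis
      unfolding psi_def rec1 rec2 rec3 dim1 dim2 dim3 ri1 ri2 ri3 using ne1 ne2 ne3 neP by auto
  next
    \<comment> \<open>The upper piece keeps the cone. The lower piece and the slice have the same
      cone but dimensions that differ by one, so their terms cancel.\<close>
    case pos
    have *: "?C \<inter> {u. a \<bullet> u \<ge> 0} = ?C" "?C \<inter> {u. a \<bullet> u \<le> 0} = ?C \<inter> {u. a \<bullet> u = 0}"
      using pos(3) by force+
    have "(-1::real) powi (aff_dim P - 1 - k) = - ((-1) powi (aff_dim P - k))" for k
      using neg_one_powi_pred[of "aff_dim P - k"] by (simp add: algebra_simps)
    then show ?thesis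
      unfolding psi_def rec1 rec2 rec3 dim1 dim2 dim3 * using ne1 ne2 ne3 neP by simp
  qed
qed

text \<open>If \<open>P\<close> lies on one side of the hyperplane, one piece is \<open>P\<close>
  and the others are empty. Otherwise \<open>psi_cut_aux\<close> applies to \<open>a\<close> or to
  \<open>-a\<close>.\<close>

lemma psi_cut:
  fixes P :: "'a::euclidean_space set"
  assumes P: "convex P" "rel_open P"
  shows "psi v P = psi v (P \<inter> {x. a \<bullet> x < b}) + psi v (P \<inter> {x. a \<bullet> x = b})
    + psi v (P \<inter> {x. a \<bullet> x > b})"
proof -
  \<comment> \<open>A relatively open convex set touching the hyperplane from one side lies in it: a
    segment from a point off the hyperplane could be prolonged through the touching point to the
    other side.\<close>
  have one_sided: "\<forall>x\<in>P. a \<bullet> x = b"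
    if ge: "\<forall>x\<in>P. a \<bullet> x \<ge> b" and x: "x \<in> P" "a \<bullet> x = b" for x a b
  proof (rule ccontr)
    assume "\<not> ?thesis"
    then obtain y where "y \<in> P" "a \<bullet> y \<noteq> b" by blast
    then have y: "y \<in> P" "a \<bullet> y > b" using ge by (auto simp: order_less_le)
    obtain e where e: "e > 1" "(1 - e) *\<^sub>R y + e *\<^sub>R x \<in> P"
      using rel_open_extend[OF P y(1) x(1)] by blast
    have "a \<bullet> ((1 - e) *\<^sub>R y + e *\<^sub>R x) = b + (1 - e) * (a \<bullet> y - b)"
      using x(2) by (simp add: inner_simps algebra_simps)
    also have "\<dots> < b" using e(1) y(2) by (simp add: mult_neg_pos)
    finally show False using ge e(2) by force
  qed
  consider (split) x y where "x \<in> P" "a \<bullet> x > b" "y \<in> P" "a \<bullet> y < b"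
    | (ge) "\<forall>x\<in>P. a \<bullet> x \<ge> b" | (le) "\<forall>x\<in>P. a \<bullet> x \<le> b"
    by (meson linorder_not_less)
  then show ?thesis
  proof cases
    case split
    show ?thesis
    proof (cases "\<exists>u\<in>rec_cone P. a \<bullet> u > 0 \<or> (\<forall>u\<in>rec_cone P. a \<bullet> u = 0)")
      case True
      show ?thesis by (rule psi_cut_aux[OF P split True])
    next
      case False
      then obtain u where "u \<in> rec_cone P" "a \<bullet> u < 0"
        using zero_in_rec_cone[of P] by (meson linorder_neqE_linordered_idom)
      \<comment> \<open>Negating \<open>a\<close> and \<open>b\<close> exchanges the two outer
        pieces.\<close>
      then have "\<exists>u\<in>rec_cone P. (-a) \<bullet> u > 0 \<or> (\<forall>u\<in>rec_cone P. (-a) \<bullet> u = 0)"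
        by auto
      from psi_cut_aux[OF P split(3) _ split(1) _ this, of "-b" v] split
      show ?thesis by (simp add: algebra_simps)
    qed
  next
    case ge
    then have 1: "P \<inter> {x. a \<bullet> x < b} = {}" by force
    show ?thesis
    proof (cases "\<exists>x\<in>P. a \<bullet> x = b")
      case True
      then have "\<forall>x\<in>P. a \<bullet> x = b" using one_sided[OF ge] by blast
      then have "P \<inter> {x. a \<bullet> x = b} = P" "P \<inter> {x. a \<bullet> x > b} = {}" by auto
      then show ?thesis by (simp add: 1)
    next
      case False
      then have "P \<inter> {x. a \<bullet> x = b} = {}" "P \<inter> {x. a \<bullet> x > b} = P"
        using ge by (auto simp: order_less_le)
      then show ?thesis by (simp add: 1)
    qed
  next
    case le
    then have 1: "P \<inter> {x. a \<bullet> x > b} = {}" by force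
    show ?thesis
    proof (cases "\<exists>x\<in>P. a \<bullet> x = b")
      case True
      then have "\<forall>x\<in>P. a \<bullet> x = b" using one_sided[of "-b" "-a"] le by auto
      then have "P \<inter> {x. a \<bullet> x = b} = P" "P \<inter> {x. a \<bullet> x < b} = {}" by auto
      then show ?thesis by (simp add: 1)
    next
      case False
      then have "P \<inter> {x. a \<bullet> x = b} = {}" "P \<inter> {x. a \<bullet> x < b} = P"
        using le by (auto simp: order_less_le)
      then show ?thesis by (simp add: 1)
    qed
  qed
qed

section \<open>Arrangements, cells and Moebius inversion\<close>

definition hyp :: "'a::real_inner \<times> real \<Rightarrow> 'a set" where
  "hyp h = {x. fst h \<bullet> x = snd h}"

text \<open>The face of the arrangement through \<open>x\<close>, i.e. the points with the same sign
  vector. Faces of all dimensions occur; the regions are the faces that avoid every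
  hyperplane.\<close>

definition cell :: "('a::real_inner \<times> real) set \<Rightarrow> 'a \<Rightarrow> 'a set" where
  "cell I x = {y. \<forall>h\<in>I. sgn (fst h \<bullet> y - snd h) = sgn (fst h \<bullet> x - snd h)}"

lemma mem_cell_self [simp]: "x \<in> cell I x"
  by (simp add: cell_def)

lemma cell_insert:
  "cell (insert h I) x = cell I x \<inter> {y. sgn (fst h \<bullet> y - snd h) = sgn (fst h \<bullet> x - snd h)}"
  by (auto simp: cell_def)

lemma cell_hyp_iff: "y \<in> cell I x \<Longrightarrow> h \<in> I \<Longrightarrow> y \<in> hyp h \<longleftrightarrow> x \<in> hyp h"
  by (force simp: cell_def hyp_def sgn_if split: if_splits)

lemma sgn_values: "sgn (r :: real) \<in> {-1, 0, 1}"
  by (simp add: sgn_if)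

text \<open>A cell depends only on the sign vector of its base point, and there are at most
  \<open>3 ^ card I\<close> sign vectors.\<close>

lemma finite_cells:
  assumes "finite I" shows "finite (range (cell I))"
proof -
  let ?s = "\<lambda>x. restrict (\<lambda>h. sgn (fst h \<bullet> x - snd h)) I"
  have "?s ` UNIV \<subseteq> (\<Pi>\<^sub>E h\<in>I. {-1, 0, 1})"
    by (intro image_subsetI) (simp add: restrict_PiE_iff sgn_values del: insert_iff)
  then have "finite (range ?s)"
    by (rule finite_subset) (auto intro!: finite_PiE assms)
  moreover have "cell I x = {y. \<forall>h\<in>I. sgn (fst h \<bullet> y - snd h) = ?s x h}" for x
    by (simp add: cell_def)
  then have "range (cell I) = (\<lambda>s. {y. \<forall>h\<in>I. sgn (fst h \<bullet> y - snd h) = s h}) ` range ?s"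
    unfolding image_image by (intro image_cong) auto
  ultimately show ?thesis by simp
qed

lemma rel_open_cell:
  fixes x :: "'a::euclidean_space"
  assumes "finite I" shows "convex (cell I x)" "rel_open (cell I x)"
proof -
  have "convex (cell I x) \<and> rel_open (cell I x)" using assms
  proof (induction I)
    case empty
    then show ?case by (simp add: cell_def rel_open_def)
  next
    case (insert h I)
    obtain a c where h: "h = (a, c)" by force
    have eq: "{y. sgn (a \<bullet> y - c) = s} =
        (if s = 1 then {y. a \<bullet> y > c} else if s = 0 then {y. a \<bullet> y = c}
         else if s = -1 then {y. a \<bullet> y < c} else {})" for s
      by (auto simp: sgn_if)
    from insert.IH have P: "convex (cell I x)" "rel_open (cell I x)" by auto
    note rel_open_cut_gt[OF P] rel_open_cut_lt[OF P] rel_open_cut_eq[OF P]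
    then show ?case
      unfolding cell_insert h fst_conv snd_conv eq by (auto simp: rel_open_def)
  qed
  then show "convex (cell I x)" "rel_open (cell I x)" by auto
qed

text \<open>Induction on the hyperplanes: a new one cuts \<open>P\<close> into three pieces, the
  faces of \<open>P\<close> are those of the three pieces, and \<open>psi_cut\<close> adds up their
  sums.\<close>

lemma psi_sum_cells:
  fixes P :: "'a::euclidean_space set"
  assumes "finite I" "convex P" "rel_open P"
  shows "(\<Sum>Q\<in>(\<lambda>x. P \<inter> cell I x) ` P. psi v Q) = psi v P"
  using assms
proof (induction I arbitrary: P)
  case empty
  have "(\<lambda>x. P \<inter> cell {} x) ` P = (if P = {} then {} else {P})"
    by (auto simp: cell_def)
  then show ?case by simp
next
  case (insert h I)
  obtain a c where h: "h = (a, c)" by force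
  let ?lt = "P \<inter> {x. a \<bullet> x < c}" and ?eq = "P \<inter> {x. a \<bullet> x = c}" and ?gt = "P \<inter> {x. a \<bullet> x > c}"
  let ?im = "\<lambda>P. (\<lambda>x. P \<inter> cell I x) ` P"
  have fin: "finite (?im P)" for P :: "'a set"
  proof -
    have "?im P \<subseteq> (\<inter>) P ` range (cell I)" by auto
    then show ?thesis
      by (rule finite_subset) (intro finite_imageI finite_cells insert.hyps)
  qed
  have "(\<lambda>x. P \<inter> cell (insert h I) x) ` P =
    (\<lambda>x. P \<inter> cell (insert h I) x) ` ?lt \<union> (\<lambda>x. P \<inter> cell (insert h I) x) ` ?eq \<union>
    (\<lambda>x. P \<inter> cell (insert h I) x) ` ?gt"
    unfolding image_Un[symmetric] by (rule arg_cong[of _ _ "image _"]) auto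
  also have "(\<lambda>x. P \<inter> cell (insert h I) x) ` ?lt = ?im ?lt"
    by (rule image_cong[OF refl]) (auto simp: cell_insert h sgn_if split: if_splits)
  also have "(\<lambda>x. P \<inter> cell (insert h I) x) ` ?eq = ?im ?eq"
    by (rule image_cong[OF refl]) (auto simp: cell_insert h sgn_if split: if_splits)
  also have "(\<lambda>x. P \<inter> cell (insert h I) x) ` ?gt = ?im ?gt"
    by (rule image_cong[OF refl]) (auto simp: cell_insert h sgn_if split: if_splits)
  finally have im: "(\<lambda>x. P \<inter> cell (insert h I) x) ` P = ?im ?lt \<union> ?im ?eq \<union> ?im ?gt" .
  \<comment> \<open>The sums run over sets of faces. Faces of different pieces differ, being
    nonempty subsets of disjoint sets.\<close>
  have d: "?im ?lt \<inter> ?im ?eq = {}" "(?im ?lt \<union> ?im ?eq) \<inter> ?im ?gt = {}"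
  proof -
    have sub: "\<And>P Q. Q \<in> ?im P \<Longrightarrow> Q \<noteq> {} \<and> Q \<subseteq> P"
      using mem_cell_self by fastforce
    show "?im ?lt \<inter> ?im ?eq = {}"
      using sub[of _ ?lt] sub[of _ ?eq] by fastforce
    show "(?im ?lt \<union> ?im ?eq) \<inter> ?im ?gt = {}"
      using sub[of _ ?lt] sub[of _ ?eq] sub[of _ ?gt] by fastforce
  qed
  have "(\<Sum>Q\<in>(\<lambda>x. P \<inter> cell (insert h I) x) ` P. psi v Q) =
      sum (psi v) (?im ?lt) + sum (psi v) (?im ?eq) + sum (psi v) (?im ?gt)"
    unfolding im
    by (subst sum.union_disjoint[OF finite_UnI[OF fin fin] fin d(2)],
        subst sum.union_disjoint[OF fin fin d(1)]) simp
  also have "\<dots> = psi v ?lt + psi v ?eq + psi v ?gt"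
    using rel_open_cut_gt[OF insert.prems] rel_open_cut_lt[OF insert.prems]
      rel_open_cut_eq[OF insert.prems] by (simp add: insert.IH)
  also have "\<dots> = psi v P"
    by (rule psi_cut[OF insert.prems, symmetric])
  finally show ?case .
qed

text \<open>An explicit solution of the equations that \<open>arr_mobius\<close> is described by.
  The test \<open>finite L\<close> makes the number of flats strictly containing \<open>X\<close> a
  termination measure.\<close>

function mobius_rec :: "'a set set \<Rightarrow> 'a set \<Rightarrow> real" where
  "mobius_rec L X = (if X = UNIV then 1 else if finite L \<and> X \<in> L
     then - (\<Sum>Y\<in>{Y\<in>L. X \<subset> Y}. mobius_rec L Y) else 0)"
  by auto
termination
proof (relation "Wellfounded.measure (\<lambda>(L, X). card {Y\<in>L. X \<subset> Y})", goal_cases)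
  case (2 L X Y)
  then have "card {Z\<in>L. Y \<subset> Z} < card {Z\<in>L. X \<subset> Z}"
    by (intro psubset_card_mono) auto
  then show ?case by simp
qed simp

declare mobius_rec.simps [simp del]

lemma UNIV_in_intersection_poset [simp]: "UNIV \<in> intersection_poset B"
  by (auto simp: intersection_poset_def intro!: exI[of _ "{}"])

lemma finite_intersection_poset:
  assumes "finite B" shows "finite (intersection_poset B)"
proof -
  have "intersection_poset B \<subseteq> Inter ` Pow B" by (auto simp: intersection_poset_def)
  then show ?thesis by (rule finite_subset) (use assms in simp)
qed

text \<open>\<open>mobius_rec\<close> provides existence; uniqueness follows by induction on the
  number of flats strictly containing \<open>X\<close>.\<close>

lemma arr_mobius_eq:
  assumes "finite B"
  shows "arr_mobius B = mobius_rec (intersection_poset B)"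
  unfolding arr_mobius_def
proof (rule the_equality)
  let ?L = "intersection_poset B"
  note fin = finite_intersection_poset[OF assms]
  show spec: "mobius_rec ?L UNIV = 1 \<and>
    (\<forall>X\<in>?L. X \<noteq> UNIV \<longrightarrow> mobius_rec ?L X = - (\<Sum>Y\<in>{Y\<in>?L. X \<subset> Y}. mobius_rec ?L Y)) \<and>
    (\<forall>X. X \<notin> ?L \<longrightarrow> mobius_rec ?L X = 0)"
  proof (intro conjI ballI allI impI)
    fix X
    show "mobius_rec ?L UNIV = 1" by (subst mobius_rec.simps) simp
    show "mobius_rec ?L X = - (\<Sum>Y\<in>{Y\<in>?L. X \<subset> Y}. mobius_rec ?L Y)" if "X \<in> ?L" "X \<noteq> UNIV"
      using that fin by (subst mobius_rec.simps) simp
    show "mobius_rec ?L X = 0" if "X \<notin> ?L"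
      using that UNIV_in_intersection_poset[of B] by (subst mobius_rec.simps) auto
  qed
  fix f :: "'a set \<Rightarrow> real"
  assume f: "f UNIV = 1 \<and> (\<forall>X\<in>?L. X \<noteq> UNIV \<longrightarrow> f X = - (\<Sum>Y\<in>{Y\<in>?L. X \<subset> Y}. f Y)) \<and>
    (\<forall>X. X \<notin> ?L \<longrightarrow> f X = 0)"
  have "f X = mobius_rec ?L X" for X
  proof (induction "card {Y\<in>?L. X \<subset> Y}" arbitrary: X rule: less_induct)
    case less
    have "f Y = mobius_rec ?L Y" if "Y \<in> {Y\<in>?L. X \<subset> Y}" for Y
      using that fin by (intro less psubset_card_mono) auto
    then have "(\<Sum>Y\<in>{Y\<in>?L. X \<subset> Y}. f Y) = (\<Sum>Y\<in>{Y\<in>?L. X \<subset> Y}. mobius_rec ?L Y)"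
      by (rule sum.cong[OF refl])
    then show ?case using f spec by metis
  qed
  then show "f = mobius_rec ?L" by blast
qed

text \<open>The recursion rearranged: under reverse inclusion the flats containing \<open>X\<close>
  form the interval from the bottom element to \<open>X\<close>.\<close>

lemma arr_mobius_sum:
  assumes "finite B" "X \<in> intersection_poset B"
  shows "(\<Sum>Y\<in>{Y\<in>intersection_poset B. X \<subseteq> Y}. arr_mobius B Y) = (if X = UNIV then 1 else 0)"
proof -
  let ?L = "intersection_poset B"
  note fin = finite_intersection_poset[OF assms(1)]
  have "{Y\<in>?L. X \<subseteq> Y} = insert X {Y\<in>?L. X \<subset> Y}" using assms(2) by auto
  then have "(\<Sum>Y\<in>{Y\<in>?L. X \<subseteq> Y}. arr_mobius B Y) =
      arr_mobius B X + (\<Sum>Y\<in>{Y\<in>?L. X \<subset> Y}. arr_mobius B Y)"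
    using fin by simp
  moreover have "{Y\<in>?L. X \<subset> Y} = {}" if "X = UNIV" using that by auto
  moreover have "mobius_rec ?L X = (if X = UNIV then 1
      else - (\<Sum>Y\<in>{Y\<in>?L. X \<subset> Y}. mobius_rec ?L Y))"
    using fin assms(2) by (subst mobius_rec.simps) simp
  ultimately show ?thesis
    unfolding arr_mobius_eq[OF assms(1)] by (cases "X = UNIV") simp_all
qed

lemma flat_affine: "X \<in> intersection_poset (hyp ` I) \<Longrightarrow> affine X"
  for X :: "'a::euclidean_space set"
  by (auto simp: intersection_poset_def hyp_def intro!: affine_Inter affine_hyperplane)

lemma flat_nonempty: "X \<in> intersection_poset B \<Longrightarrow> X \<noteq> {}"
  by (auto simp: intersection_poset_def)

text \<open>Lying on a hyperplane means sign 0, and signs are constant on a cell.\<close>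

lemma cell_subset_flat:
  assumes "X \<in> intersection_poset (hyp ` I)"
  shows "cell I x \<subseteq> X \<longleftrightarrow> x \<in> X"
proof
  show "x \<in> X" if "cell I x \<subseteq> X" using that mem_cell_self by blast
  assume x: "x \<in> X"
  from assms obtain S where S: "S \<subseteq> hyp ` I" "X = \<Inter>S" by (auto simp: intersection_poset_def)
  show "cell I x \<subseteq> X"
    using S x cell_hyp_iff[of _ I x] by blast
qed

lemma psi_flat:
  fixes X :: "'a::euclidean_space set"
  assumes "finite I" "X \<in> intersection_poset (hyp ` I)"
  shows "psi v X = (\<Sum>F\<in>{F\<in>range (cell I). F \<subseteq> X}. psi v F)"
proof -
  have "affine X" using assms by (simp add: flat_affine)
  then have "psi v X = (\<Sum>Q\<in>(\<lambda>x. X \<inter> cell I x) ` X. psi v Q)"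
    by (intro psi_sum_cells[symmetric] assms affine_imp_convex affine_rel_open)
  also have "(\<lambda>x. X \<inter> cell I x) ` X = cell I ` X"
    using cell_subset_flat[OF assms(2)] by (intro image_cong) auto
  also have "\<dots> = {F\<in>range (cell I). F \<subseteq> X}"
    using cell_subset_flat[OF assms(2)] by auto
  finally show ?thesis .
qed

text \<open>Write \<open>psi v X\<close> as a sum over the faces in \<open>X\<close> and exchange
  the sums. The coefficient of a face is the sum of the Moebius values of all flats containing it,
  which is 1 if the face is a region and 0 otherwise.\<close>

lemma psi_mobius_sum:
  fixes I :: "('a::euclidean_space \<times> real) set"
  assumes fin: "finite I" and nz: "\<And>h. h \<in> I \<Longrightarrow> fst h \<noteq> 0"
  shows "(\<Sum>X\<in>intersection_poset (hyp ` I). arr_mobius (hyp ` I) X * psi v X) =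
    (\<Sum>R\<in>cell I ` (UNIV - \<Union>(hyp ` I)). psi v R)"
proof -
  let ?L = "intersection_poset (hyp ` I)" and ?mu = "arr_mobius (hyp ` I)"
  let ?F = "range (cell I)"
  have finL: "finite ?L" using fin by (simp add: finite_intersection_poset)
  have finF: "finite ?F" using fin by (rule finite_cells)
  have upper: "(\<Sum>X\<in>{X\<in>?L. cell I x \<subseteq> X}. ?mu X) = (if x \<in> UNIV - \<Union>(hyp ` I) then 1 else 0)" for x
  proof -
    \<comment> \<open>The smallest flat through \<open>x\<close>; it is the whole space exactly when
      \<open>x\<close> lies on no hyperplane.\<close>
    define Y where "Y = \<Inter>{H \<in> hyp ` I. x \<in> H}"
    have Y: "Y \<in> ?L" by (auto simp: Y_def intersection_poset_def)
    have "x \<in> X \<longleftrightarrow> Y \<subseteq> X" if "X \<in> ?L" for X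
    proof
      show "x \<in> X" if "Y \<subseteq> X" using that by (auto simp: Y_def)
      show "Y \<subseteq> X" if "x \<in> X" using that \<open>X \<in> ?L\<close> unfolding Y_def intersection_poset_def by blast
    qed
    then have "{X\<in>?L. cell I x \<subseteq> X} = {X\<in>?L. Y \<subseteq> X}"
      using cell_subset_flat[of _ I x] by blast
    moreover have "Y = UNIV \<longleftrightarrow> x \<in> UNIV - \<Union>(hyp ` I)"
    proof -
      \<comment> \<open>A zero normal with offset zero would put every point on a hyperplane and
        still leave \<open>Y = UNIV\<close>.\<close>
      have "hyp h \<noteq> UNIV" if "h \<in> I" for h
      proof
        assume "hyp h = UNIV"
        then have "0 \<in> hyp h" "fst h \<in> hyp h" by auto
        then show False using nz[OF that] by (simp add: hyp_def)
      qed
      then have "Y = UNIV \<longleftrightarrow> {H \<in> hyp ` I. x \<in> H} = {}"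
        unfolding Y_def by (metis (mono_tags, lifting) Inf_empty Inter_lower ex_in_conv imageE
            mem_Collect_eq top.extremum_uniqueI)
      also have "\<dots> \<longleftrightarrow> x \<in> UNIV - \<Union>(hyp ` I)" by blast
      finally show ?thesis .
    qed
    ultimately show ?thesis using arr_mobius_sum[OF _ Y] fin by simp
  qed
  have "(\<Sum>X\<in>?L. ?mu X * psi v X) = (\<Sum>X\<in>?L. \<Sum>F\<in>?F. if F \<subseteq> X then ?mu X * psi v F else 0)"
    by (intro sum.cong refl)
      (simp add: psi_flat[OF fin] sum_distrib_left sum.inter_filter[OF finF, symmetric])
  also have "\<dots> = (\<Sum>F\<in>?F. \<Sum>X\<in>?L. if F \<subseteq> X then ?mu X * psi v F else 0)"
    by (rule sum.swap)
  also have "\<dots> = (\<Sum>F\<in>?F. (\<Sum>X\<in>{X\<in>?L. F \<subseteq> X}. ?mu X) * psi v F)"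
    by (intro sum.cong refl) (simp add: sum_distrib_right sum.inter_filter[OF finL, symmetric])
  also have "\<dots> = (\<Sum>F\<in>?F. if F \<in> cell I ` (UNIV - \<Union>(hyp ` I)) then psi v F else 0)"
  proof (intro sum.cong refl)
    fix F assume "F \<in> ?F"
    then obtain x where x: "F = cell I x" by blast
    \<comment> \<open>Whether \<open>F\<close> is a region does not depend on the chosen
      representative \<open>x\<close>.\<close>
    have "x \<in> UNIV - \<Union>(hyp ` I)" if "F \<in> cell I ` (UNIV - \<Union>(hyp ` I))"
    proof -
      from that obtain y where y: "y \<in> UNIV - \<Union>(hyp ` I)" "cell I x = cell I y" using x by auto
      then have "x \<in> cell I y" using mem_cell_self[of x I] by simp
      then show ?thesis using y(1) by (simp add: cell_hyp_iff)
    qed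
    then have "F \<in> cell I ` (UNIV - \<Union>(hyp ` I)) \<longleftrightarrow> x \<in> UNIV - \<Union>(hyp ` I)"
      using x by blast
    then show "(\<Sum>X\<in>{X\<in>?L. F \<subseteq> X}. ?mu X) * psi v F =
        (if F \<in> cell I ` (UNIV - \<Union>(hyp ` I)) then psi v F else 0)"
      using upper[of x] x by simp
  qed
  also have "\<dots> = (\<Sum>R\<in>{F\<in>?F. F \<in> cell I ` (UNIV - \<Union>(hyp ` I))}. psi v R)"
    by (rule sum.inter_filter[OF finF, symmetric])
  also have "{F\<in>?F. F \<in> cell I ` (UNIV - \<Union>(hyp ` I))} = cell I ` (UNIV - \<Union>(hyp ` I))"
    by auto
  finally show ?thesis .
qed

text \<open>Cells are convex, hence connected. Conversely, a connected set on which some sign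
  changes meets the corresponding hyperplane by the intermediate value theorem.\<close>

lemma components_arrangement:
  fixes I :: "('a::euclidean_space \<times> real) set"
  assumes fin: "finite I"
  shows "components (UNIV - \<Union>(hyp ` I)) = cell I ` (UNIV - \<Union>(hyp ` I))"
proof -
  let ?U = "UNIV - \<Union>(hyp ` I)"
  have "connected_component_set ?U x = cell I x" if x: "x \<in> ?U" for x
  proof
    show "cell I x \<subseteq> connected_component_set ?U x"
    proof (rule connected_component_maximal)
      show "connected (cell I x)" using fin by (simp add: rel_open_cell convex_connected)
      show "cell I x \<subseteq> ?U" using x cell_hyp_iff[of _ I x] by blast
    qed simp
    let ?C = "connected_component_set ?U x"
    have C: "connected ?C" "?C \<subseteq> ?U" by (auto simp: connected_component_subset)
    have xC: "x \<in> ?C" using x by simp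
    show "?C \<subseteq> cell I x"
    proof (rule ccontr)
      assume "\<not> ?C \<subseteq> cell I x"
      then obtain y a c where y: "y \<in> ?C" "(a, c) \<in> I" "sgn (a \<bullet> y - c) \<noteq> sgn (a \<bullet> x - c)"
        by (force simp: cell_def)
      have "\<exists>z\<in>?C. a \<bullet> z = c"
        using connected_ivt_hyperplane[OF C(1) y(1) xC, of a c]
          connected_ivt_hyperplane[OF C(1) xC y(1), of a c] y
        by (auto simp: sgn_if split: if_splits)
      then show False using C(2) y(2) by (force simp: hyp_def)
    qed
  qed
  then show ?thesis by (auto simp: components_def)
qed

section \<open>Direction spaces of flats\<close>

lemma rec_cone_affine:
  fixes X :: "'a::euclidean_space set"
  assumes "affine X" "x \<in> X"
  shows "rec_cone X = {u. x + u \<in> X}" "subspace (rec_cone X)" "aff_dim X = int (dim (rec_cone X))"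
proof -
  show eq: "rec_cone X = {u. x + u \<in> X}"
  proof (intro set_eqI iffI)
    fix u assume "u \<in> rec_cone X"
    then have "\<forall>t\<ge>0. x + t *\<^sub>R u \<in> X" using assms(2) by (simp add: rec_cone_def)
    from this[rule_format, of 1] show "u \<in> {u. x + u \<in> X}" by simp
  next
    fix u assume u: "u \<in> {u. x + u \<in> X}"
    have "y + t *\<^sub>R (x + u) + (- t) *\<^sub>R x \<in> X" if "y \<in> X" for y t
      using mem_affine_3[OF assms(1) that, of "x + u" x 1 t "- t"] u assms(2) by simp
    then show "u \<in> rec_cone X" by (simp add: rec_cone_def algebra_simps)
  qed
  have "{u. x + u \<in> X} = (\<lambda>y. -x + y) ` X"
    by (force simp: image_iff intro: bexI[of _ "x + _"])
  then have eq2: "rec_cone X = (\<lambda>y. -x + y) ` X" using eq by simp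
  have "affine (rec_cone X)" unfolding eq2 using affine_translation assms(1) by blast
  then show sub: "subspace (rec_cone X)"
    by (simp add: subspace_affine)
  have "aff_dim (rec_cone X) = aff_dim X" unfolding eq2 by (rule aff_dim_translation_eq)
  then show "aff_dim X = int (dim (rec_cone X))" using aff_dim_subspace[OF sub] by simp
qed

text \<open>The recession cone is the direction space, which is its own relative interior and has
  the dimension of \<open>X\<close>, so the exponent is 0.\<close>

lemma psi_affine:
  fixes X :: "'a::euclidean_space set"
  assumes "affine X" "X \<noteq> {}"
  shows "psi v X = (if v \<in> rec_cone X then 1 else 0)"
proof -
  from assms obtain x where x: "x \<in> X" by blast
  note r = rec_cone_affine[OF assms(1) x]
  have "rel_interior (rec_cone X) = rec_cone X"
    by (intro rel_interior_affine subspace_imp_affine r)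
  then show ?thesis using assms(2) r(3) aff_dim_subspace[OF r(2)] by (simp add: psi_def)
qed

section \<open>The Coxeter arrangement of type B\<close>

text \<open>A strictly increasing map is determined by its image, and every subset of
  \<open>S\<close> of size \<open>card D\<close> is such an image. This will count the integer
  points of a Coxeter cell.\<close>

lemma card_strict_mono_funcs:
  fixes D :: "'a::linorder set" and S :: "'b::linorder set"
  assumes D: "finite D" and S: "finite S"
  shows "card {f \<in> D \<rightarrow>\<^sub>E S. strict_mono_on D f} = card S choose card D"
proof -
  let ?F = "{f \<in> D \<rightarrow>\<^sub>E S. strict_mono_on D f}"
  have inj: "inj_on f D" if "strict_mono_on D f" for f :: "'a \<Rightarrow> 'b"
    using that by (rule strict_mono_on_imp_inj_on)
  have sorted: "map f (sorted_list_of_set D) = sorted_list_of_set (f ` D)"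
    if "strict_mono_on D f" for f :: "'a \<Rightarrow> 'b"
  proof (rule sorted_distinct_set_unique)
    show "sorted (map f (sorted_list_of_set D))"
      unfolding sorted_map
      by (rule sorted_wrt_mono_rel[OF _ strict_sorted_list_of_set])
        (use D in \<open>auto intro!: less_imp_le strict_mono_onD[OF that]\<close>)
    show "distinct (map f (sorted_list_of_set D))"
      using inj[OF that] D by (simp add: distinct_map)
  qed (use D in simp_all)
  have "bij_betw (\<lambda>f. f ` D) ?F {T. T \<subseteq> S \<and> card T = card D}"
    unfolding bij_betw_def
  proof (intro conjI inj_onI equalityI subsetI)
    fix f g assume f: "f \<in> ?F" and g: "g \<in> ?F" and "f ` D = g ` D"
    then have "map f (sorted_list_of_set D) = map g (sorted_list_of_set D)"
      using sorted[of f] sorted[of g] by simp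
    then have "\<forall>x\<in>D. f x = g x" using D by (simp only: map_eq_conv set_sorted_list_of_set)
    moreover have "f \<in> D \<rightarrow>\<^sub>E S" "g \<in> D \<rightarrow>\<^sub>E S" using f g by simp_all
    ultimately show "f = g" by (metis PiE_ext)
  next
    fix T assume "T \<in> (\<lambda>f. f ` D) ` ?F"
    then show "T \<in> {T. T \<subseteq> S \<and> card T = card D}"
      using card_image[OF inj] by (auto dest: PiE_mem)
  next
    fix T assume "T \<in> {T. T \<subseteq> S \<and> card T = card D}"
    then have T: "T \<subseteq> S" "card T = card D" "finite T" using S finite_subset by auto
    let ?xs = "sorted_list_of_set D" and ?ys = "sorted_list_of_set T"
    \<comment> \<open>\<open>r x\<close> is the rank of \<open>x\<close> in \<open>D\<close>;
      \<open>f\<close> sends it to the element of \<open>T\<close> of the same rank.\<close>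
    define r where "r x = card {y\<in>D. y < x}" for x
    define f where "f = restrict (\<lambda>x. ?ys ! r x) D"
    have r: "r x < card D" if "x \<in> D" for x
      unfolding r_def using that D by (intro psubset_card_mono) auto
    have sm: "strict_mono_on D f"
    proof (rule strict_mono_onI)
      fix x y assume xy: "x \<in> D" "y \<in> D" "x < y"
      then have "r x < r y"
        unfolding r_def using D by (intro psubset_card_mono) auto
      then have "?ys ! r x < ?ys ! r y"
        using r[OF xy(2)] T by (intro sorted_wrt_nth_less[OF strict_sorted_list_of_set]) auto
      then show "f x < f y" using xy by (simp add: f_def)
    qed
    have fT: "f \<in> D \<rightarrow>\<^sub>E T"
    proof (rule PiE_I)
      fix x assume "x \<in> D"
      then have "f x = ?ys ! r x" "r x < length ?ys" using r T by (simp_all add: f_def)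
      then have "f x \<in> set ?ys" using nth_mem[of "r x" ?ys] by simp
      then show "f x \<in> T" using T(3) by simp
    qed (simp add: f_def)
    have "card (f ` D) = card T" using T(2) card_image[OF inj[OF sm]] by simp
    moreover have "f ` D \<subseteq> T" using fT by (auto dest: PiE_mem)
    ultimately have "f ` D = T" by (intro card_subset_eq[OF T(3)])
    moreover have "f \<in> ?F" using fT sm T(1) by (auto simp: PiE_iff)
    ultimately show "T \<in> (\<lambda>f. f ` D) ` ?F" by (intro image_eqI[of _ _ f]) simp_all
  qed
  then show ?thesis using n_subsets[OF S, of "card D"] by (simp add: bij_betw_same_card)
qed

text \<open>Normals for all directions of type B. Only the differences occur with both signs, so
  this is not the full root system.\<close>

definition roots :: "(real^'n) set" where
  "roots = {axis i 1 | i. True} \<union> {axis i 1 - axis j 1 | i j. i \<noteq> j}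
     \<union> {axis i 1 + axis j 1 | i j. i \<noteq> j}"

lemma finite_roots: "finite (roots :: (real^'n) set)"
proof -
  have "roots \<subseteq> range (\<lambda>i::'n. axis i 1) \<union> range (\<lambda>(i::'n, j). axis i 1 - axis j 1)
      \<union> range (\<lambda>(i::'n, j). axis i 1 + axis j (1::real))"
    by (auto simp: roots_def)
  then show ?thesis by (rule finite_subset) auto
qed

lemma ball_roots: "(\<forall>\<alpha>\<in>roots. Q \<alpha>) \<longleftrightarrow>
  (\<forall>i. Q (axis i 1)) \<and> (\<forall>i j. i \<noteq> j \<longrightarrow> Q (axis i 1 - axis j 1)) \<and>
  (\<forall>i j. i \<noteq> j \<longrightarrow> Q (axis i 1 + axis j 1))"
proof -
  have *: "(\<forall>x\<in>{f i j | i j. R i j}. Q x) \<longleftrightarrow> (\<forall>i j. R i j \<longrightarrow> Q (f i j))"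
    "(\<forall>x\<in>{g i | i. True}. Q x) \<longleftrightarrow> (\<forall>i. Q (g i))"
    for R :: "'b \<Rightarrow> 'b \<Rightarrow> bool" and f g
    by auto
  show ?thesis unfolding roots_def by (simp only: ball_Un * conj_assoc)
qed

lemma zero_notin_roots: "0 \<notin> roots"
proof
  assume "(0 :: real^'n) \<in> roots"
  then consider i where "(0 :: real^'n) = axis i 1" 
    | i j where "i \<noteq> j" "(0 :: real^'n) = axis i 1 - axis j 1"
    | i j where "i \<noteq> j" "(0 :: real^'n) = axis i 1 + axis j 1"
    unfolding roots_def by blast
  then show False
  proof cases
    case (1 i) then show ?thesis by (metis axis_eq_0_iff zero_neq_one)
  next
    case (2 i j)
    then have "(axis i 1 - axis j 1 :: real^'n) $ i = 0" by (metis zero_index)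
    with 2(1) show ?thesis by (simp add: axis_def)
  next
    case (3 i j)
    then have "(axis i 1 + axis j 1 :: real^'n) $ i = 0" by (metis zero_index)
    with 3(1) show ?thesis by (simp add: axis_def)
  qed
qed

definition coxB :: "((real^'n) \<times> real) set" where
  "coxB = roots \<times> {0}"

lemma sgn_add_cases:
  fixes a c :: real
  shows "sgn (a + c) = (if \<bar>a\<bar> < \<bar>c\<bar> then sgn c else if \<bar>c\<bar> < \<bar>a\<bar> then sgn a
    else if sgn a = sgn c then sgn a else 0)"
  by (cases a "0::real" rule: linorder_cases; cases c "0::real" rule: linorder_cases)
    (simp_all add: sgn_if)

lemma sgn_add_cong:
  fixes a b c d :: real
  assumes "sgn a = sgn b" "sgn c = sgn d" "\<bar>a\<bar> < \<bar>c\<bar> \<longleftrightarrow> \<bar>b\<bar> < \<bar>d\<bar>" "\<bar>c\<bar> < \<bar>a\<bar> \<longleftrightarrow> \<bar>d\<bar> < \<bar>b\<bar>"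
  shows "sgn (a + c) = sgn (b + d)"
  by (simp only: sgn_add_cases assms)

lemma abs_less_iff_sgn:
  fixes a b :: real
  shows "\<bar>a\<bar> < \<bar>b\<bar> \<longleftrightarrow> sgn (a - b) * sgn (a + b) = -1"
proof -
  have "\<bar>a\<bar> < \<bar>b\<bar> \<longleftrightarrow> a\<^sup>2 < b\<^sup>2"
    by (meson abs_le_square_iff linorder_not_le)
  also have "\<dots> \<longleftrightarrow> sgn ((a - b) * (a + b)) = -1"
    by (simp add: sgn_if algebra_simps power2_eq_square)
  finally show ?thesis by (simp only: sgn_mult)
qed

lemma mem_coxB_cell: "u \<in> cell coxB v \<longleftrightarrow> (\<forall>\<alpha>\<in>roots. sgn (\<alpha> \<bullet> u) = sgn (\<alpha> \<bullet> v))"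
  by (auto simp: cell_def coxB_def)

text \<open>The signs of sums and differences determine the comparisons of absolute values through
  (a - b)(a + b) = a^2 - b^2. Conversely, a sum has the sign of its summand of larger absolute
  value.\<close>

lemma mem_coxB_cell_iff:
  "u \<in> cell coxB v \<longleftrightarrow>
    (\<forall>i. sgn (u$i) = sgn (v$i)) \<and> (\<forall>i j. \<bar>u$i\<bar> < \<bar>u$j\<bar> \<longleftrightarrow> \<bar>v$i\<bar> < \<bar>v$j\<bar>)"
proof -
  have "u \<in> cell coxB v \<longleftrightarrow> (\<forall>\<alpha>\<in>roots. sgn (\<alpha> \<bullet> u) = sgn (\<alpha> \<bullet> v))"
    by (rule mem_coxB_cell)
  also have "\<dots> \<longleftrightarrow> (\<forall>i. sgn (u$i) = sgn (v$i)) \<and>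
      (\<forall>i j. i \<noteq> j \<longrightarrow> sgn (u$i - u$j) = sgn (v$i - v$j)) \<and>
      (\<forall>i j. i \<noteq> j \<longrightarrow> sgn (u$i + u$j) = sgn (v$i + v$j))" (is "_ \<longleftrightarrow> ?L")
    by (simp add: ball_roots inner_simps inner_axis')
  also have "\<dots> \<longleftrightarrow> (\<forall>i. sgn (u$i) = sgn (v$i)) \<and> (\<forall>i j. \<bar>u$i\<bar> < \<bar>u$j\<bar> \<longleftrightarrow> \<bar>v$i\<bar> < \<bar>v$j\<bar>)"
    (is "_ \<longleftrightarrow> ?R")
  proof
    assume L: ?L
    have "\<bar>u$i\<bar> < \<bar>u$j\<bar> \<longleftrightarrow> \<bar>v$i\<bar> < \<bar>v$j\<bar>" for i j
    proof (cases "i = j")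
      case False
      then show ?thesis using L by (simp add: abs_less_iff_sgn)
    qed simp
    then show ?R by (intro conjI allI conjunct1[OF L, THEN spec])
  next
    assume R: ?R
    have s: "sgn (u$i) = sgn (v$i)" and o: "\<bar>u$i\<bar> < \<bar>u$j\<bar> \<longleftrightarrow> \<bar>v$i\<bar> < \<bar>v$j\<bar>" for i j
      using R by (fast, fast)
    have "sgn (u$i + u$j) = sgn (v$i + v$j)" for i j
      by (intro sgn_add_cong s o)
    moreover have "sgn (u$i + (- u$j)) = sgn (v$i + (- v$j))" for i j
      by (intro sgn_add_cong) (simp_all only: sgn_minus s abs_minus_cancel o)
    ultimately show ?L using s by simp
  qed
  finally show ?thesis .
qed

text \<open>\<open>cflat v\<close> is the smallest flat of the Coxeter arrangement that contains \<open>v\<close>. Its points have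
  one free coordinate for every distinct nonzero absolute value \<open>\<bar>v$i\<bar>\<close>.\<close>

definition cflat :: "real^'n \<Rightarrow> (real^'n) set" where
  "cflat v = {u. \<forall>\<alpha>\<in>roots. \<alpha> \<bullet> v = 0 \<longrightarrow> \<alpha> \<bullet> u = 0}"

section \<open>Coordinates on the Coxeter flats\<close>

definition mags :: "real^'n \<Rightarrow> real set" where
  "mags v = range (\<lambda>i. \<bar>v$i\<bar>) - {0}"

text \<open>Parametrises \<open>cflat v\<close>: \<open>y\<close> gives one free value per
  magnitude, and \<open>v\<close> gives the signs. Where \<open>v\<close> vanishes the sign factor
  is 0, so \<open>y 0\<close> has no influence.\<close>

definition sgnvec :: "real^'n \<Rightarrow> (real \<Rightarrow> real) \<Rightarrow> real^'n" where
  "sgnvec v y = (\<chi> i. sgn (v$i) * y \<bar>v$i\<bar>)"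

lemma sgnvec_nth [simp]: "sgnvec v y $ i = sgn (v$i) * y \<bar>v$i\<bar>"
  by (simp add: sgnvec_def)

lemma finite_mags [simp]: "finite (mags v)"
  by (simp add: mags_def)

lemma abs_mem_mags: "v$i \<noteq> 0 \<Longrightarrow> \<bar>v$i\<bar> \<in> mags v"
  by (auto simp: mags_def)

lemma subspace_cflat: "subspace (cflat v)"
  by (auto simp: cflat_def subspace_def inner_simps)

lemma sgnvec_mem_cflat: "sgnvec v y \<in> cflat v"
proof -
  let ?u = "sgnvec v y"
  have 1: "?u $ i = 0" if "v$i = 0" for i using that by simp
  have 2: "?u $ i - ?u $ j = 0" if "v$i - v$j = 0" for i j using that by simp
  have 3: "?u $ i + ?u $ j = 0" if "v$i + v$j = 0" for i j
  proof -
    have "v$i = - v$j" using that by linarith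
    then show ?thesis by (simp add: sgn_minus)
  qed
  show ?thesis
    unfolding cflat_def mem_Collect_eq ball_roots
    by (simp only: inner_diff_left inner_add_left inner_axis' mult_1 inner_real_def)
      (intro conjI allI impI 1 2 3)
qed

lemma mem_cflatD:
  assumes "u \<in> cflat v"
  shows "v$i = 0 \<Longrightarrow> u$i = 0" "v$i = v$j \<Longrightarrow> u$i = u$j" "v$i = - v$j \<Longrightarrow> u$i = - u$j"
proof -
  have *: "(\<forall>i. v$i = 0 \<longrightarrow> u$i = 0) \<and>
      (\<forall>i j. i \<noteq> j \<longrightarrow> v$i - v$j = 0 \<longrightarrow> u$i - u$j = 0) \<and>
      (\<forall>i j. i \<noteq> j \<longrightarrow> v$i + v$j = 0 \<longrightarrow> u$i + u$j = 0)"
    using assms unfolding cflat_def mem_Collect_eq ball_roots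
    by (simp only: inner_diff_left inner_add_left inner_axis' mult_1 simp_thms inner_real_def)
  note 1 = conjunct1[OF *] and 2 = conjunct1[OF conjunct2[OF *]] and 3 = conjunct2[OF conjunct2[OF *]]
  show "v$i = 0 \<Longrightarrow> u$i = 0" using 1 by simp
  show "u$i = u$j" if "v$i = v$j"
    using 2[rule_format, of i j] that by (cases "i = j") simp_all
  show "u$i = - u$j" if eq: "v$i = - v$j"
  proof (cases "i = j")
    case True
    then show ?thesis using 1[rule_format, of i] eq by simp
  next
    case False
    then show ?thesis using 3[rule_format, OF False] eq by (simp add: eq_neg_iff_add_eq_0)
  qed
qed

lemma inj_on_sgnvec: "inj_on (sgnvec v) (mags v \<rightarrow>\<^sub>E T)"
proof (rule inj_onI)
  fix y z assume y: "y \<in> mags v \<rightarrow>\<^sub>E T" and z: "z \<in> mags v \<rightarrow>\<^sub>E T" and eq: "sgnvec v y = sgnvec v z"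
  have "y d = z d" if d: "d \<in> mags v" for d
  proof -
    obtain i where i: "d = \<bar>v$i\<bar>" "v$i \<noteq> 0" using d by (auto simp: mags_def)
    have "sgnvec v y $ i = sgnvec v z $ i" using eq by simp
    then show ?thesis using i by (simp add: sgn_eq_0_iff)
  qed
  then show "y = z" using y z by (intro PiE_ext[of y "mags v" "\<lambda>_. T" z]) auto
qed

text \<open>Coordinates at which \<open>v\<close> has equal magnitude agree in \<open>u\<close> up
  to the signs of \<open>v\<close>, so the value of \<open>y\<close> at a magnitude may be read off
  at any such coordinate.\<close>

lemma cflat_obtain:
  assumes "u \<in> cflat v"
  obtains y where "y \<in> extensional (mags v)" "u = sgnvec v y"
    "\<And>i. v$i \<noteq> 0 \<Longrightarrow> y \<bar>v$i\<bar> = sgn (v$i) * u$i"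
proof -
  define y where "y = restrict (\<lambda>d. let i = (SOME i. \<bar>v$i\<bar> = d) in sgn (v$i) * u$i) (mags v)"
  have y: "y \<bar>v$i\<bar> = sgn (v$i) * u$i" if "v$i \<noteq> 0" for i
  proof -
    define j where "j = (SOME j. \<bar>v$j\<bar> = \<bar>v$i\<bar>)"
    have "\<bar>v$j\<bar> = \<bar>v$i\<bar>" unfolding j_def by (rule someI[of _ i]) simp
    then consider (eq) "v$j = v$i" | (neg) "v$j = - v$i" by linarith
    then have "sgn (v$j) * u$j = sgn (v$i) * u$i"
    proof cases
      case eq
      then show ?thesis using mem_cflatD(2)[OF assms eq] by simp
    next
      case neg
      then show ?thesis using mem_cflatD(3)[OF assms neg] by (simp add: sgn_minus)
    qed
    moreover have "y \<bar>v$i\<bar> = sgn (v$j) * u$j"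
      using abs_mem_mags[OF that] by (simp add: y_def Let_def j_def)
    ultimately show ?thesis by simp
  qed
  have "u = sgnvec v y"
    unfolding vec_eq_iff
  proof
    fix i
    show "u$i = sgnvec v y $ i"
    proof (cases "v$i = 0")
      case True then show ?thesis using mem_cflatD(1)[OF assms] by simp
    next
      case False
      then show ?thesis by (simp add: y sgn_if)
    qed
  qed
  moreover have "y \<in> extensional (mags v)" by (simp add: y_def)
  ultimately show ?thesis using y by (intro that[of y])
qed

text \<open>The vectors \<open>w d\<close>, one for each magnitude, have disjoint supports, so they
  are orthogonal; by the parametrisation they span \<open>cflat v\<close>.\<close>

lemma dim_cflat: "dim (cflat v) = card (mags v)"
proof -
  define w where "w d = sgnvec v (\<lambda>e. if e = d then 1 else 0)" for d
  have w0: "w d \<noteq> 0" if d: "d \<in> mags v" for d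
  proof -
    obtain i where "d = \<bar>v$i\<bar>" "v$i \<noteq> 0" using d by (auto simp: mags_def)
    then have "w d $ i \<noteq> 0" by (simp add: w_def sgn_eq_0_iff)
    then show ?thesis by auto
  qed
  have orth: "w d \<bullet> w e = 0" if "d \<noteq> e" for d e
    using that by (auto simp: inner_vec_def w_def intro!: sum.neutral)
  have inj: "inj_on w (mags v)"
    using orth w0 by (metis inj_onI inner_eq_zero_iff)
  have ind: "independent (w ` mags v)"
    using w0 by (intro pairwise_orthogonal_independent)
      (auto simp: pairwise_def orthogonal_def intro!: orth)
  have "span (w ` mags v) = cflat v"
  proof
    show "span (w ` mags v) \<subseteq> cflat v"
      by (intro span_minimal subspace_cflat) (auto simp: w_def sgnvec_mem_cflat)
    show "cflat v \<subseteq> span (w ` mags v)"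
    proof
      fix u assume "u \<in> cflat v"
      then obtain y where y: "u = sgnvec v y" by (elim cflat_obtain)
      have "sgnvec v y = (\<Sum>d\<in>mags v. y d *\<^sub>R w d)"
      proof (unfold vec_eq_iff, intro allI)
        fix i
        have "(y d *\<^sub>R w d) $ i = (if d = \<bar>v$i\<bar> then sgn (v$i) * y \<bar>v$i\<bar> else 0)" for d
          by (simp add: w_def)
        then have "(\<Sum>d\<in>mags v. y d *\<^sub>R w d) $ i =
            (\<Sum>d\<in>mags v. if d = \<bar>v$i\<bar> then sgn (v$i) * y \<bar>v$i\<bar> else 0)"
          by (simp only: sum_component)
        also have "\<dots> = sgn (v$i) * y \<bar>v$i\<bar>"
          using abs_mem_mags[of v i] by (cases "v$i = 0") (simp_all add: sum.delta)
        finally show "sgnvec v y $ i = (\<Sum>d\<in>mags v. y d *\<^sub>R w d) $ i" by simp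
      qed
      moreover have "(\<Sum>d\<in>mags v. y d *\<^sub>R w d) \<in> span (w ` mags v)"
        by (intro span_sum span_scale span_base imageI)
      ultimately show "u \<in> span (w ` mags v)" by (simp only: y)
    qed
  qed
  then have "dim (cflat v) = card (w ` mags v)"
    using dim_span_eq_card_independent[OF ind] by (simp only:)
  then show ?thesis using inj by (simp add: card_image)
qed

section \<open>Integer points in flats and cells of the Coxeter arrangement\<close>

definition zbox :: "nat \<Rightarrow> (real^'n) set" where
  "zbox m = {u. \<forall>i. u$i \<in> real_of_int ` {- int m..int m}}"

lemma finite_zbox: "finite (zbox m :: (real^'n) set)"
proof -
  have "(zbox m :: (real^'n) set) \<subseteq> vec_lambda ` (UNIV \<rightarrow>\<^sub>E real_of_int ` {- int m..int m})"
  proof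
    fix u :: "real^'n" assume "u \<in> zbox m"
    then have "vec_nth u \<in> UNIV \<rightarrow>\<^sub>E real_of_int ` {- int m..int m}" by (auto simp: zbox_def)
    then show "u \<in> vec_lambda ` (UNIV \<rightarrow>\<^sub>E real_of_int ` {- int m..int m})"
      by (intro image_eqI[of _ _ "vec_nth u"]) auto
  qed
  then show ?thesis by (rule finite_subset) (intro finite_imageI finite_PiE, auto)
qed

text \<open>The range of the entries is closed under multiplication by a sign, so the points
  correspond to arbitrary maps from \<open>mags v\<close> into that range.\<close>

lemma card_cflat_zbox: "card (cflat v \<inter> zbox m) = (2 * m + 1) ^ card (mags v)"
proof -
  let ?T = "real_of_int ` {- int m..int m}"
  have T0: "0 \<in> ?T" and Tm: "- x \<in> ?T" if "x \<in> ?T" for x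
    using that by (force simp: image_iff intro: bexI[of _ "- _"])+
  have Tsgn: "sgn a * x \<in> ?T" if "x \<in> ?T" for a :: real and x
    using that T0 Tm by (auto simp: sgn_if)
  have "cflat v \<inter> zbox m = sgnvec v ` (mags v \<rightarrow>\<^sub>E ?T)"
  proof (intro equalityI subsetI)
    fix u assume u: "u \<in> cflat v \<inter> zbox m"
    then obtain y where y: "y \<in> extensional (mags v)" "u = sgnvec v y"
      "\<And>i. v$i \<noteq> 0 \<Longrightarrow> y \<bar>v$i\<bar> = sgn (v$i) * u$i"
      by (elim IntE cflat_obtain) blast
    have "y d \<in> ?T" if "d \<in> mags v" for d
    proof -
      obtain i where i: "d = \<bar>v$i\<bar>" "v$i \<noteq> 0" using \<open>d \<in> mags v\<close> by (auto simp: mags_def)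
      have "u$i \<in> ?T" using u by (simp add: zbox_def)
      then show ?thesis using Tsgn y(3)[OF i(2)] i(1) by simp
    qed
    then show "u \<in> sgnvec v ` (mags v \<rightarrow>\<^sub>E ?T)" using y(1,2) by (auto simp: PiE_def)
  next
    fix u assume "u \<in> sgnvec v ` (mags v \<rightarrow>\<^sub>E ?T)"
    then obtain y where y: "y \<in> mags v \<rightarrow>\<^sub>E ?T" "u = sgnvec v y" by blast
    have "u$i \<in> ?T" for i
    proof (cases "v$i = 0")
      case True
      then show ?thesis using T0[of 0] by (simp add: y(2))
    next
      case False
      then have "y \<bar>v$i\<bar> \<in> ?T" using y(1) abs_mem_mags[of v i] by auto
      then show ?thesis using Tsgn by (simp add: y(2))
    qed
    then show "u \<in> cflat v \<inter> zbox m" using y(2) by (simp add: zbox_def sgnvec_mem_cflat)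
  qed
  then have "card (cflat v \<inter> zbox m) = card (mags v \<rightarrow>\<^sub>E ?T)"
    by (simp add: card_image inj_on_sgnvec)
  also have "\<dots> = card ?T ^ card (mags v)" by (simp add: card_PiE)
  also have "card ?T = 2 * m + 1" by (subst card_image) (auto simp: inj_on_def)
  finally show ?thesis .
qed

lemma cell_coxB_subset_cflat: "cell coxB v \<subseteq> cflat v"
proof
  fix u assume "u \<in> cell coxB v"
  then have "\<forall>\<alpha>\<in>roots. sgn (\<alpha> \<bullet> u) = sgn (\<alpha> \<bullet> v)"
    by (simp only: mem_coxB_cell)
  then have "\<alpha> \<bullet> u = 0" if "\<alpha> \<in> roots" "\<alpha> \<bullet> v = 0" for \<alpha>
    using that by (metis sgn_eq_0_iff)
  then show "u \<in> cflat v" by (simp add: cflat_def)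
qed

text \<open>Inside the cell the free values must be positive, to keep the signs, and increase
  strictly with the magnitude, to keep the order. The points thus correspond to strictly increasing
  maps from \<open>mags v\<close> to 1, ..., m.\<close>

lemma card_cell_zbox: "card (cell coxB v \<inter> zbox m) = m choose card (mags v)"
proof -
  let ?T = "real ` {1..m}"
  let ?F = "{y \<in> mags v \<rightarrow>\<^sub>E ?T. strict_mono_on (mags v) y}"
  have "cell coxB v \<inter> zbox m = sgnvec v ` ?F"
  proof (intro equalityI subsetI)
    fix u assume u: "u \<in> cell coxB v \<inter> zbox m"
    then have "u \<in> cflat v" by (intro subsetD[OF cell_coxB_subset_cflat IntD1])
    then obtain y where y: "y \<in> extensional (mags v)" "u = sgnvec v y"
      "\<And>i. v$i \<noteq> 0 \<Longrightarrow> y \<bar>v$i\<bar> = sgn (v$i) * u$i"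
      by (elim cflat_obtain) blast
    from u have s: "sgn (u$i) = sgn (v$i)" and o: "\<bar>u$i\<bar> < \<bar>u$j\<bar> \<longleftrightarrow> \<bar>v$i\<bar> < \<bar>v$j\<bar>" for i j
      by (auto simp: mem_coxB_cell_iff)
    have ya: "y \<bar>v$i\<bar> = \<bar>u$i\<bar>" if "v$i \<noteq> 0" for i
      using y(3)[OF that] s[of i] by (simp add: abs_sgn mult.commute)
    have "y d \<in> ?T" if "d \<in> mags v" for d
    proof -
      obtain i where i: "d = \<bar>v$i\<bar>" "v$i \<noteq> 0" using \<open>d \<in> mags v\<close> by (auto simp: mags_def)
      obtain k where k: "u$i = real_of_int k" "\<bar>k\<bar> \<le> int m"
        using u by (force simp: zbox_def)
      have "u$i \<noteq> 0" using s[of i] i(2) by (metis sgn_eq_0_iff)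
      then have "nat \<bar>k\<bar> \<in> {1..m}" "\<bar>u$i\<bar> = real (nat \<bar>k\<bar>)" using k by auto
      then have "\<bar>u$i\<bar> \<in> ?T" by (metis imageI)
      then show ?thesis by (simp only: ya[OF i(2)] i(1))
    qed
    moreover have "strict_mono_on (mags v) y"
    proof (rule strict_mono_onI)
      fix d e assume "d \<in> mags v" "e \<in> mags v" "d < e"
      moreover then obtain i j where "d = \<bar>v$i\<bar>" "v$i \<noteq> 0" "e = \<bar>v$j\<bar>" "v$j \<noteq> 0"
        by (auto simp: mags_def)
      ultimately show "y d < y e" using o by (simp add: ya)
    qed
    ultimately show "u \<in> sgnvec v ` ?F" using y(1,2) by (auto simp: PiE_def)
  next
    fix u assume "u \<in> sgnvec v ` ?F"
    then obtain y where y: "y \<in> mags v \<rightarrow>\<^sub>E ?T" "strict_mono_on (mags v) y" "u = sgnvec v y" by blast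
    have yT: "y \<bar>v$i\<bar> \<in> ?T" if "v$i \<noteq> 0" for i
      using y(1) abs_mem_mags[OF that] by auto
    then have pos: "y \<bar>v$i\<bar> > 0" if "v$i \<noteq> 0" for i using that by force
    have "u$i \<in> real_of_int ` {- int m..int m}" for i
    proof (cases "v$i = 0")
      case True
      then show ?thesis by (auto simp: y(3) image_iff intro!: bexI[of _ 0])
    next
      case False
      then obtain k where k: "k \<in> {1..m}" "y \<bar>v$i\<bar> = real k" using yT by blast
      then have "u$i = real_of_int (int k) \<or> u$i = real_of_int (- int k)"
        using False by (auto simp: y(3) sgn_if)
      moreover have "int k \<in> {- int m..int m}" "- int k \<in> {- int m..int m}" using k(1) by auto
      ultimately show ?thesis by blast
    qed
    moreover have "sgn (u$i) = sgn (v$i)" for i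
      using pos[of i] by (cases "v$i = 0") (simp_all add: y(3) sgn_mult)
    moreover have "\<bar>u$i\<bar> < \<bar>u$j\<bar> \<longleftrightarrow> \<bar>v$i\<bar> < \<bar>v$j\<bar>" for i j
    proof -
      have abs: "\<bar>u$i\<bar> = (if v$i = 0 then 0 else y \<bar>v$i\<bar>)" for i
        using pos[of i] by (cases "v$i = 0") (simp_all add: y(3) abs_mult abs_sgn_eq)
      show ?thesis
        using pos[of i] pos[of j] strict_mono_on_less[OF y(2) abs_mem_mags[of v i] abs_mem_mags[of v j]]
        by (cases "v$i = 0"; cases "v$j = 0") (simp_all add: abs order_less_imp_not_less)
    qed
    ultimately show "u \<in> cell coxB v \<inter> zbox m" by (simp add: mem_coxB_cell_iff zbox_def)
  qed
  moreover have "inj_on (sgnvec v) ?F"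
    by (rule inj_on_subset[OF inj_on_sgnvec]) auto
  ultimately have "card (cell coxB v \<inter> zbox m) = card ?F" by (simp add: card_image)
  also have "\<dots> = card ?T choose card (mags v)" by (rule card_strict_mono_funcs) auto
  also have "card ?T = m" by (subst card_image) (auto simp: inj_on_def)
  finally show ?thesis .
qed

text \<open>Choose \<open>v\<close> in \<open>U\<close> orthogonal to as few roots as possible. If
  some \<open>u\<close> in \<open>U\<close> were outside \<open>cflat v\<close>, a perturbation of
  \<open>v\<close> along \<open>u\<close> would be orthogonal to fewer roots.\<close>

lemma generic_point:
  fixes U :: "(real^'n) set"
  assumes A: "A \<subseteq> roots" and U: "U = {u. \<forall>\<alpha>\<in>A. \<alpha> \<bullet> u = 0}"
  obtains v where "cflat v = U"
proof -
  define Z :: "real^'n \<Rightarrow> (real^'n) set" where "Z v = {\<alpha>\<in>roots. \<alpha> \<bullet> v = 0}" for v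
  have finZ: "finite (Z v)" for v by (simp add: Z_def finite_roots)
  have "0 \<in> U" by (simp add: U)
  then obtain v where v: "v \<in> U" and min: "\<And>w. w \<in> U \<Longrightarrow> card (Z v) \<le> card (Z w)"
    using exists_least_iff[of "\<lambda>n. \<exists>v\<in>U. card (Z v) = n"] by (metis linorder_not_less)
  have "cflat v = U"
  proof
    show "cflat v \<subseteq> U" using v A by (auto simp: cflat_def U)
    show "U \<subseteq> cflat v"
    proof (rule ccontr)
      assume "\<not> U \<subseteq> cflat v"
      then obtain u \<alpha> where u: "u \<in> U" "\<alpha> \<in> roots" "\<alpha> \<bullet> v = 0" "\<alpha> \<bullet> u \<noteq> 0"
        by (auto simp: cflat_def)
      \<comment> \<open>The parameters at which a root nonzero on \<open>u\<close> would vanish on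
        the perturbed vector. A root with \<beta> \<bullet> u = 0 contributes the quotient 0, which
        is excluded anyway.\<close>
      have "finite (insert 0 ((\<lambda>\<beta>. - (\<beta> \<bullet> v) / (\<beta> \<bullet> u)) ` roots))"
        by (simp add: finite_roots)
      then obtain t where t: "t \<noteq> 0" "\<And>\<beta>. \<beta> \<in> roots \<Longrightarrow> t \<noteq> - (\<beta> \<bullet> v) / (\<beta> \<bullet> u)"
        using ex_new_if_finite[OF infinite_UNIV_char_0, of "insert 0 ((\<lambda>\<beta>. - (\<beta> \<bullet> v) / (\<beta> \<bullet> u)) ` roots)"]
        by blast
      have "Z (v + t *\<^sub>R u) \<subset> Z v"
      proof
        show "Z (v + t *\<^sub>R u) \<subseteq> Z v"
        proof
          fix \<beta> assume "\<beta> \<in> Z (v + t *\<^sub>R u)"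
          then have \<beta>: "\<beta> \<in> roots" "\<beta> \<bullet> v + t * (\<beta> \<bullet> u) = 0" by (auto simp: Z_def inner_simps)
          have "\<beta> \<bullet> u = 0"
          proof (rule ccontr)
            assume "\<beta> \<bullet> u \<noteq> 0"
            then have "t = - (\<beta> \<bullet> v) / (\<beta> \<bullet> u)" using \<beta>(2) by (simp add: field_simps)
            then show False using t(2)[OF \<beta>(1)] by blast
          qed
          then show "\<beta> \<in> Z v" using \<beta> by (simp add: Z_def)
        qed
        have "\<alpha> \<in> Z v" "\<alpha> \<notin> Z (v + t *\<^sub>R u)" using u t(1) by (auto simp: Z_def inner_simps)
        then show "Z (v + t *\<^sub>R u) \<noteq> Z v" by blast
      qed
      then have "card (Z (v + t *\<^sub>R u)) < card (Z v)" by (intro psubset_card_mono finZ)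
      moreover have "v + t *\<^sub>R u \<in> U" using u(1) v by (simp add: U inner_simps)
      ultimately show False using min by (meson not_less)
    qed
  qed
  then show ?thesis using that by blast
qed

section \<open>Recession cones and levels of regions\<close>

text \<open>A linear form of constant weak sign on \<open>C\<close> that vanishes at a relative
  interior point vanishes on \<open>C\<close>: the segment from \<open>u\<close> to \<open>v\<close>
  can be prolonged beyond \<open>v\<close>, where the form would have the opposite sign.\<close>

lemma rel_open_cone_eq_zero:
  fixes C :: "'a::euclidean_space set"
  assumes "convex C" "v \<in> rel_interior C" "\<And>u. u \<in> C \<Longrightarrow> s * (a \<bullet> u) \<ge> 0" "a \<bullet> v = 0" "u \<in> C"
    and "s \<noteq> 0"
  shows "a \<bullet> u = 0"
proof -
  have "C \<noteq> {}" using assms(5) by blast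
  then obtain e where e: "e > 1" "(1 - e) *\<^sub>R u + e *\<^sub>R v \<in> C"
    using assms(2,5) convex_rel_interior_iff[OF assms(1)] by blast
  have "(1 - e) * (s * (a \<bullet> u)) \<ge> 0"
    using assms(3)[OF e(2)] assms(4) by (simp add: inner_simps algebra_simps)
  then have "s * (a \<bullet> u) \<le> 0" using e(1) by (simp add: zero_le_mult_iff)
  with assms(3)[OF assms(5)] have "s * (a \<bullet> u) = 0" by simp
  then show ?thesis using assms(6) by simp
qed

lemma rec_cone_flat_eq:
  fixes X :: "'a::euclidean_space set"
  assumes "X \<in> intersection_poset (hyp ` I)"
  obtains A where "A \<subseteq> fst ` I" "rec_cone X = {u. \<forall>\<alpha>\<in>A. \<alpha> \<bullet> u = 0}"
proof -
  obtain S where S: "S \<subseteq> hyp ` I" "X = \<Inter>S" "X \<noteq> {}"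
    using assms by (auto simp: intersection_poset_def)
  then obtain x where x: "x \<in> X" by blast
  let ?J = "{h \<in> I. hyp h \<in> S}"
  have X: "y \<in> X \<longleftrightarrow> (\<forall>h\<in>?J. y \<in> hyp h)" for y
    using S(1,2) by blast
  have "rec_cone X = {u. x + u \<in> X}"
    by (rule rec_cone_affine(1)[OF flat_affine[OF assms] x])
  also have "\<dots> = {u. \<forall>\<alpha>\<in>fst ` ?J. \<alpha> \<bullet> u = 0}"
    using x by (simp add: X) (simp add: hyp_def inner_simps)
  finally show ?thesis by (rule that[rotated]) blast
qed

text \<open>The direction space of \<open>X\<close> is a flat of the Coxeter arrangement, hence
  \<open>cflat v\<close> for a generic \<open>v\<close>; both its dimension and its number of
  integer points are governed by \<open>mags v\<close>.\<close>

lemma card_rec_cone_flat_zbox: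
  fixes X :: "(real^'n) set"
  assumes "X \<in> intersection_poset (hyp ` I)" "fst ` I \<subseteq> roots"
  shows "card (rec_cone X \<inter> zbox m) = (2 * m + 1) ^ nat (aff_dim X)"
proof -
  obtain A where A: "A \<subseteq> fst ` I" "rec_cone X = {u. \<forall>\<alpha>\<in>A. \<alpha> \<bullet> u = 0}"
    using rec_cone_flat_eq[OF assms(1)] .
  have "A \<subseteq> roots" using A(1) assms(2) by (rule order_trans)
  then obtain v where v: "cflat v = rec_cone X" using generic_point[OF _ A(2)] by blast
  obtain x where x: "x \<in> X" using flat_nonempty[OF assms(1)] by blast
  have "aff_dim X = int (dim (cflat v))"
    unfolding v by (rule rec_cone_affine(3)[OF flat_affine[OF assms(1)] x])
  then have "nat (aff_dim X) = card (mags v)" by (simp add: dim_cflat)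
  then show ?thesis using card_cflat_zbox[of v m] by (simp only: v)
qed

text \<open>Off the hyperplanes all signs are nonzero, so the cell is an intersection of open
  half-spaces, and its recession cone is given by the homogeneous weak inequalities.\<close>

lemma rec_cone_open_cell:
  assumes "x \<notin> \<Union>(hyp ` I)"
  shows "rec_cone (cell I x) = {u. \<forall>h\<in>I. sgn (fst h \<bullet> x - snd h) * (fst h \<bullet> u) \<ge> 0}"
proof (intro set_eqI iffI)
  fix u assume u: "u \<in> rec_cone (cell I x)"
  show "u \<in> {u. \<forall>h\<in>I. sgn (fst h \<bullet> x - snd h) * (fst h \<bullet> u) \<ge> 0}"
  proof (rule CollectI, rule ballI, rule ccontr)
    fix h assume h: "h \<in> I" and neg: "\<not> sgn (fst h \<bullet> x - snd h) * (fst h \<bullet> u) \<ge> 0"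
    define d where "d = fst h \<bullet> x - snd h"
    define k where "k = fst h \<bullet> u"
    from neg have "sgn d * k < 0" by (simp add: d_def k_def)
    then have k: "k \<noteq> 0" "d \<noteq> 0" "- d / k > 0"
      by (auto simp: sgn_if zero_less_divide_iff divide_less_0_iff split: if_splits)
    moreover have "\<forall>t\<ge>0. x + t *\<^sub>R u \<in> cell I x"
      using u mem_cell_self[of x I] unfolding rec_cone_def by blast
    \<comment> \<open>This is the point where the ray meets the hyperplane, so its sign would be 0
      instead of \<open>sgn d\<close>.\<close>
    ultimately have "x + (- d / k) *\<^sub>R u \<in> cell I x"
      by (metis less_imp_le)
    then have "sgn (fst h \<bullet> (x + (- d / k) *\<^sub>R u) - snd h) = sgn d"
      using h by (simp add: cell_def d_def)
    moreover have "fst h \<bullet> (x + (- d / k) *\<^sub>R u) - snd h = d + (- d / k) * k"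
      by (simp add: inner_simps d_def k_def)
    ultimately show False using k by (simp add: sgn_if split: if_splits)
  qed
next
  fix u assume u: "u \<in> {u. \<forall>h\<in>I. sgn (fst h \<bullet> x - snd h) * (fst h \<bullet> u) \<ge> 0}"
  show "u \<in> rec_cone (cell I x)"
    unfolding rec_cone_def
  proof safe
    fix y and t :: real assume y: "y \<in> cell I x" and t: "t \<ge> 0"
    show "y + t *\<^sub>R u \<in> cell I x"
      unfolding cell_def
    proof (rule CollectI, rule ballI)
      fix h assume h: "h \<in> I"
      define d where "d = fst h \<bullet> x - snd h"
      define e where "e = fst h \<bullet> y - snd h"
      define k where "k = t * (fst h \<bullet> u)"
      have "sgn e = sgn d" using y h by (simp add: cell_def d_def e_def)
      moreover have "d \<noteq> 0" using assms h by (auto simp: hyp_def d_def)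
      moreover have "sgn d * (fst h \<bullet> u) \<ge> 0" using u h by (simp add: d_def)
      then have "t * (sgn d * (fst h \<bullet> u)) \<ge> 0" using t by (rule mult_nonneg_nonneg[rotated])
      then have "sgn d * k \<ge> 0" by (simp add: k_def mult.left_commute)
      ultimately have "sgn (e + k) = sgn d"
        by (auto simp: sgn_if split: if_splits)
      then show "sgn (fst h \<bullet> (y + t *\<^sub>R u) - snd h) = sgn (fst h \<bullet> x - snd h)"
        by (simp add: inner_simps d_def e_def k_def algebra_simps)
    qed
  qed
qed

text \<open>Non-degeneracy enters here: every root is a normal in \<open>I\<close>, so it has
  constant weak sign on the cone. A root vanishing at one relative interior point vanishes on the
  whole cone, so all such points have the root signs of \<open>v\<close>. Conversely,
  \<open>cell coxB v\<close> lies in the cone and is open in \<open>cflat v\<close>, which contains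
  the cone.\<close>

lemma region_rec_cone:
  fixes I :: "((real^'n) \<times> real) set"
  assumes roots: "fst ` I = roots" and x: "x \<notin> \<Union>(hyp ` I)"
    and fin: "finite I" and v: "v \<in> rel_interior (rec_cone (cell I x))"
  shows "rel_interior (rec_cone (cell I x)) = cell coxB v"
    and "rec_cone (cell I x) \<subseteq> cflat v"
    and "aff_dim (rec_cone (cell I x)) = int (card (mags v))"
proof -
  let ?C = "rec_cone (cell I x)"
  have C: "?C = {u. \<forall>h\<in>I. sgn (fst h \<bullet> x - snd h) * (fst h \<bullet> u) \<ge> 0}"
    by (rule rec_cone_open_cell[OF x])
  have conv: "convex ?C" using fin by (intro convex_rec_cone rel_open_cell)
  have vC: "v \<in> ?C" using v rel_interior_subset by blast
  have sg: "\<exists>s. s \<noteq> 0 \<and> (\<forall>u\<in>?C. s * (\<alpha> \<bullet> u) \<ge> 0)" if "\<alpha> \<in> roots" for \<alpha>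
  proof -
    from that obtain h where h: "h \<in> I" "fst h = \<alpha>" using roots by (metis imageE)
    have "fst h \<bullet> x - snd h \<noteq> 0" using x h(1) by (auto simp: hyp_def)
    then have "sgn (fst h \<bullet> x - snd h) \<noteq> 0" by (simp only: sgn_eq_0_iff not_False_eq_True)
    moreover have "\<forall>u\<in>?C. sgn (fst h \<bullet> x - snd h) * (\<alpha> \<bullet> u) \<ge> 0"
      using h by (auto simp: C)
    ultimately show ?thesis by blast
  qed
  have zero: "\<alpha> \<bullet> u = 0" if "\<alpha> \<in> roots" "w \<in> rel_interior ?C" "\<alpha> \<bullet> w = 0" "u \<in> ?C" for \<alpha> u w
  proof -
    from sg[OF that(1)] obtain s where s: "s \<noteq> 0" "\<And>u. u \<in> ?C \<Longrightarrow> s * (\<alpha> \<bullet> u) \<ge> 0" by blast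
    show ?thesis by (rule rel_open_cone_eq_zero[OF conv that(2) s(2) that(3,4) s(1)])
  qed
  have "?C \<subseteq> cflat v"
    using zero[OF _ v] by (auto simp: cflat_def)
  then show CU: "?C \<subseteq> cflat v" .
  have cellC: "cell coxB v \<subseteq> ?C"
  proof
    fix u assume "u \<in> cell coxB v"
    then have u: "\<forall>\<alpha>\<in>roots. sgn (\<alpha> \<bullet> u) = sgn (\<alpha> \<bullet> v)" by (simp only: mem_coxB_cell)
    have "sgn (fst h \<bullet> x - snd h) * (fst h \<bullet> u) \<ge> 0" if h: "h \<in> I" for h
    proof -
      have "fst h \<in> roots" using h roots by blast
      then have "sgn (fst h \<bullet> u) = sgn (fst h \<bullet> v)" using u by blast
      moreover have "sgn (fst h \<bullet> x - snd h) * (fst h \<bullet> v) \<ge> 0" using vC h by (auto simp: C)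
      ultimately show ?thesis by (auto simp: sgn_if split: if_splits)
    qed
    then show "u \<in> ?C" by (simp add: C)
  qed
  \<comment> \<open>Together with the equations of \<open>cflat v\<close>, these strict inequalities
    describe the cell, which is therefore open in \<open>cflat v\<close>.\<close>
  define U where "U = (\<Inter>\<alpha>\<in>{\<alpha>\<in>roots. \<alpha> \<bullet> v \<noteq> 0}. {u. (sgn (\<alpha> \<bullet> v) *\<^sub>R \<alpha>) \<bullet> u > 0})"
  have "open U"
    unfolding U_def using finite_roots by (intro open_INT ballI open_halfspace_gt) auto
  moreover have "cell coxB v = cflat v \<inter> U"
  proof (intro equalityI subsetI)
    fix u assume u: "u \<in> cell coxB v"
    then have s: "\<forall>\<alpha>\<in>roots. sgn (\<alpha> \<bullet> u) = sgn (\<alpha> \<bullet> v)" by (simp only: mem_coxB_cell)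
    have "sgn (\<alpha> \<bullet> v) * (\<alpha> \<bullet> u) > 0" if "\<alpha> \<in> roots" "\<alpha> \<bullet> v \<noteq> 0" for \<alpha>
      using s[rule_format, OF that(1)] that(2) by (auto simp: sgn_if split: if_splits)
    then have "u \<in> U" by (auto simp: U_def)
    then show "u \<in> cflat v \<inter> U" using cell_coxB_subset_cflat u by blast
  next
    fix u assume u: "u \<in> cflat v \<inter> U"
    have "sgn (\<alpha> \<bullet> u) = sgn (\<alpha> \<bullet> v)" if a: "\<alpha> \<in> roots" for \<alpha>
    proof (cases "\<alpha> \<bullet> v = 0")
      case True
      then show ?thesis using u a by (simp add: cflat_def)
    next
      case False
      then have "sgn (\<alpha> \<bullet> v) * (\<alpha> \<bullet> u) > 0" using u a by (auto simp: U_def)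
      then show ?thesis using False by (auto simp: sgn_if split: if_splits)
    qed
    then show "u \<in> cell coxB v" by (simp add: mem_coxB_cell)
  qed
  ultimately have op: "openin (top_of_set (cflat v)) (cell coxB v)"
    by (auto simp: openin_open)
  have aff: "affine (cflat v)" by (rule subspace_imp_affine[OF subspace_cflat])
  have ne: "cell coxB v \<noteq> {}" using mem_cell_self by blast
  have "aff_dim (cell coxB v) = int (card (mags v))"
    using aff_dim_openin[OF op aff ne] aff_dim_subspace[OF subspace_cflat[of v]]
    by (simp add: dim_cflat)
  moreover have "aff_dim (cell coxB v) \<le> aff_dim ?C" using cellC by (rule aff_dim_subset)
  moreover have "aff_dim ?C \<le> int (card (mags v))"
    using aff_dim_subset[OF CU] aff_dim_subspace[OF subspace_cflat[of v]] by (simp add: dim_cflat)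
  ultimately show "aff_dim ?C = int (card (mags v))" by simp
  show "rel_interior ?C = cell coxB v"
  proof
    have "affine hull ?C \<subseteq> cflat v" by (intro hull_minimal CU aff)
    then have "openin (top_of_set (affine hull ?C)) (cell coxB v)"
      using openin_subset_trans[OF op] cellC hull_subset[of ?C affine] by blast
    then show "cell coxB v \<subseteq> rel_interior ?C"
      using rel_interior_maximal cellC by blast
    show "rel_interior ?C \<subseteq> cell coxB v"
    proof
      fix u assume u: "u \<in> rel_interior ?C"
      then have uC: "u \<in> ?C" using rel_interior_subset by blast
      have "sgn (\<alpha> \<bullet> u) = sgn (\<alpha> \<bullet> v)" if a: "\<alpha> \<in> roots" for \<alpha>
      proof (cases "\<alpha> \<bullet> v = 0")
        case True
        then show ?thesis using zero[OF a v True uC] by simp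
      next
        case False
        then have "\<alpha> \<bullet> u \<noteq> 0" using zero[OF a u _ vC] by blast
        moreover obtain s where "s \<noteq> 0" "s * (\<alpha> \<bullet> u) \<ge> 0" "s * (\<alpha> \<bullet> v) \<ge> 0"
          using sg[OF a] uC vC by blast
        ultimately show ?thesis using False
          by (auto simp: sgn_if zero_le_mult_iff split: if_splits)
      qed
      then show "u \<in> cell coxB v" by (simp add: mem_coxB_cell)
    qed
  qed
qed

section \<open>Levels of regions\<close>

text \<open>Normalise an unbounded sequence in \<open>Q\<close> and pass to a limit on the unit
  sphere. Division by the norms sends the right-hand sides to 0, so the limit satisfies the
  homogeneous inequalities and would have to be 0.\<close>

lemma bounded_if_no_recession:
  fixes Q :: "'a::euclidean_space set"
  assumes M: "subspace M" "Q \<subseteq> M"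
    and Q: "\<And>q h. q \<in> Q \<Longrightarrow> h \<in> J \<Longrightarrow> fst h \<bullet> q \<le> snd h"
    and rec: "\<And>y. y \<in> M \<Longrightarrow> (\<And>h. h \<in> J \<Longrightarrow> fst h \<bullet> y \<le> 0) \<Longrightarrow> y = 0"
  shows "bounded Q"
proof (rule ccontr)
  assume "\<not> bounded Q"
  then have "\<exists>q\<in>Q. norm q > real (Suc n)" for n
    unfolding bounded_iff by (meson linorder_not_le)
  then obtain q where q: "\<And>n. q n \<in> Q" "\<And>n. norm (q n) > real (Suc n)" by metis
  define y where "y n = inverse (norm (q n)) *\<^sub>R q n" for n
  have pos: "norm (q n) > 0" for n using q(2)[of n] of_nat_0_le_iff[of "Suc n", where 'a = real] by linarith
  have "y n \<in> sphere 0 1" for n using pos[of n] by (simp add: y_def)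
  then obtain l r where l: "l \<in> sphere 0 1" and r: "strict_mono r" and lim: "(y \<circ> r) \<longlonglongrightarrow> l"
    using compact_sphere[of "0::'a" 1] unfolding compact_def by blast
  have "(y \<circ> r) n \<in> M" for n
    using q(1)[of "r n"] M by (auto simp: y_def intro: subspace_scale)
  then have "l \<in> M"
    by (rule closed_sequentially[OF closed_subspace[OF M(1)] _ lim])
  moreover have "fst h \<bullet> l \<le> 0" if h: "h \<in> J" for h
  proof (rule LIMSEQ_le)
    show "(\<lambda>n. fst h \<bullet> (y \<circ> r) n) \<longlonglongrightarrow> fst h \<bullet> l"
      by (intro tendsto_inner tendsto_const lim)
    show "(\<lambda>n. \<bar>snd h\<bar> * inverse (real (Suc n))) \<longlonglongrightarrow> 0"
      using tendsto_mult_right_zero[OF LIMSEQ_inverse_real_of_nat] .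
    have "fst h \<bullet> (y \<circ> r) n \<le> \<bar>snd h\<bar> * inverse (real (Suc n))" for n
    proof -
      have "real (Suc n) \<le> norm (q (r n))"
        using q(2)[of "r n"] seq_suble[OF r, of n] by simp
      then have inv: "inverse (norm (q (r n))) \<le> inverse (real (Suc n))"
        by (intro le_imp_inverse_le) auto
      have "fst h \<bullet> (y \<circ> r) n = inverse (norm (q (r n))) * (fst h \<bullet> q (r n))"
        by (simp add: y_def)
      also have "\<dots> \<le> inverse (norm (q (r n))) * \<bar>snd h\<bar>"
        using Q[OF q(1) h, of "r n"] by (intro mult_left_mono) auto
      also have "\<dots> \<le> inverse (real (Suc n)) * \<bar>snd h\<bar>"
        using inv by (intro mult_right_mono) auto
      finally show ?thesis by (simp add: mult.commute)
    qed
    then show "\<exists>N. \<forall>n\<ge>N. fst h \<bullet> (y \<circ> r) n \<le> \<bar>snd h\<bar> * inverse (real (Suc n))" by blast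
  qed
  ultimately have "l = 0" by (rule rec)
  then show False using l by simp
qed

text \<open>If \<open>u\<close> had a nonzero component \<open>q\<close> orthogonal to
  \<open>W\<close>, the distance from \<open>W\<close> would grow linearly along a ray in direction
  \<open>u\<close>.\<close>

lemma rec_cone_subset_subspace:
  fixes P :: "'a::euclidean_space set"
  assumes W: "subspace W" and P: "P \<noteq> {}" "P \<subseteq> {x. infdist x W \<le> r}"
  shows "rec_cone P \<subseteq> W"
proof
  fix u assume u: "u \<in> rec_cone P"
  obtain x where x: "x \<in> P" using P(1) by blast
  obtain p q where pq: "p \<in> span W" "\<And>w. w \<in> span W \<Longrightarrow> orthogonal q w" "u = p + q"
    using orthogonal_subspace_decomp_exists[of W u] by metis
  have spW: "span W = W" using W by simp
  have "q = 0"
  proof (rule ccontr)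
    assume q: "q \<noteq> 0"
    have bound: "q \<bullet> x + t * (q \<bullet> q) \<le> norm q * r" if "t \<ge> 0" for t
    proof -
      have "x + t *\<^sub>R u \<in> P" using u x that by (simp add: rec_cone_def)
      then have le: "infdist (x + t *\<^sub>R u) W \<le> r" using P(2) by blast
      have "W \<noteq> {}" using subspace_0[OF W] by blast
      then obtain w where w: "w \<in> W" "infdist (x + t *\<^sub>R u) W = dist (x + t *\<^sub>R u) w"
        using infdist_attains_inf[OF closed_subspace[OF W], of "x + t *\<^sub>R u"] by blast
      have "q \<bullet> w = 0" "q \<bullet> p = 0" using pq(1,2) w(1) spW by (auto simp: orthogonal_def)
      then have "q \<bullet> x + t * (q \<bullet> q) = q \<bullet> (x + t *\<^sub>R u - w)"
        by (simp add: pq(3) inner_simps)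
      also have "\<dots> \<le> norm q * norm (x + t *\<^sub>R u - w)" by (rule norm_cauchy_schwarz)
      also have "\<dots> \<le> norm q * r" using le w(2) by (intro mult_left_mono) (auto simp: dist_norm)
      finally show ?thesis .
    qed
    have qq: "q \<bullet> q > 0" using q by simp
    \<comment> \<open>Chosen so that \<open>t\<close> times \<open>q \<bullet> q\<close> exceeds
      what \<open>bound\<close> permits.\<close>
    define t where "t = (\<bar>norm q * r\<bar> + \<bar>q \<bullet> x\<bar> + 1) / (q \<bullet> q)"
    have "t \<ge> 0" using qq by (simp add: t_def)
    moreover have "t * (q \<bullet> q) = \<bar>norm q * r\<bar> + \<bar>q \<bullet> x\<bar> + 1" using qq by (simp add: t_def)
    ultimately show False using bound[of t] by linarith
  qed
  then show "u \<in> W" using pq spW by simp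
qed

text \<open>Project the region orthogonally to \<open>cflat v\<close>. Normals that vanish at
  \<open>v\<close> vanish on \<open>cflat v\<close>, so the inequalities from \<open>J\<close>
  survive and confine the projection to \<open>Q\<close>. If \<open>y\<close> in \<open>M\<close>
  satisfies the homogeneous inequalities from \<open>J\<close>, adding a large multiple of
  \<open>v\<close> gives an element of the recession cone, hence of \<open>cflat v\<close>; so
  \<open>y\<close> lies in \<open>cflat v\<close>, is orthogonal to it, and is 0. Thus
  \<open>Q\<close> is bounded.\<close>

lemma region_near_cflat:
  fixes I :: "((real^'n) \<times> real) set"
  assumes roots: "fst ` I = roots" and x: "x \<notin> \<Union>(hyp ` I)"
    and fin: "finite I" and v: "v \<in> rel_interior (rec_cone (cell I x))"
  shows "\<exists>r>0. cell I x \<subseteq> {z. infdist z (cflat v) \<le> r}"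
proof -
  let ?C = "rec_cone (cell I x)" and ?W = "cflat v"
  define s where "s h = sgn (fst h \<bullet> x - snd h)" for h
  define J where "J = {h \<in> I. fst h \<bullet> v = 0}"
  define M where "M = {y. \<forall>w\<in>?W. w \<bullet> y = 0}"
  define Q where "Q = {q \<in> M. \<forall>h\<in>J. s h * (fst h \<bullet> q - snd h) \<ge> 0}"
  have C: "?C = {u. \<forall>h\<in>I. s h * (fst h \<bullet> u) \<ge> 0}"
    unfolding s_def by (rule rec_cone_open_cell[OF x])
  have CW: "?C \<subseteq> ?W" by (rule region_rec_cone(2)[OF assms])
  have vC: "v \<in> ?C" using v rel_interior_subset by blast
  have s1: "\<bar>s h\<bar> = 1" if "h \<in> I" for h
    using x that by (auto simp: s_def hyp_def abs_sgn_eq)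
  have spW: "span ?W = ?W" using subspace_cflat by (simp add: span_eq_iff)
  have vW: "v \<in> ?W" using vC CW by blast
  have "bounded Q"
  proof (rule bounded_if_no_recession[where M = M and J = "(\<lambda>h. (- s h *\<^sub>R fst h, - s h * snd h)) ` J"])
    show "subspace M" by (auto simp: M_def subspace_def inner_simps)
    show "Q \<subseteq> M" by (auto simp: Q_def)
    show "fst h \<bullet> q \<le> snd h" if "q \<in> Q" "h \<in> (\<lambda>h. (- s h *\<^sub>R fst h, - s h * snd h)) ` J" for q h
      using that by (auto simp: Q_def algebra_simps)
    fix y assume y: "y \<in> M"
      and "\<And>h. h \<in> (\<lambda>h. (- s h *\<^sub>R fst h, - s h * snd h)) ` J \<Longrightarrow> fst h \<bullet> y \<le> 0"
    then have yJ: "s h * (fst h \<bullet> y) \<ge> 0" if "h \<in> J" for h using that by fastforce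
    \<comment> \<open>Large enough for every \<open>h\<close> outside \<open>J\<close>, as each
      summand is nonnegative and the summand of \<open>h\<close> is the bound it requires. Summands
      from \<open>J\<close> are 0, being quotients by 0.\<close>
    define k where "k = (\<Sum>h\<in>I. \<bar>fst h \<bullet> y\<bar> / \<bar>fst h \<bullet> v\<bar>)"
    have "y + k *\<^sub>R v \<in> ?C"
      unfolding C
    proof (rule CollectI, rule ballI)
      fix h assume h: "h \<in> I"
      show "s h * (fst h \<bullet> (y + k *\<^sub>R v)) \<ge> 0"
      proof (cases "h \<in> J")
        case True
        then show ?thesis using yJ[OF True] by (simp add: J_def inner_simps)
      next
        case False
        then have nz: "fst h \<bullet> v \<noteq> 0" using h by (simp add: J_def)
        have "s h * (fst h \<bullet> v) \<ge> 0" using vC h by (simp add: C)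
        then have eq: "s h * (fst h \<bullet> v) = \<bar>fst h \<bullet> v\<bar>"
          using s1[OF h] by (metis abs_mult abs_of_nonneg mult_1)
        have "\<bar>fst h \<bullet> y\<bar> / \<bar>fst h \<bullet> v\<bar> \<le> k"
          unfolding k_def by (rule member_le_sum[OF h _ fin]) auto
        then have "\<bar>fst h \<bullet> y\<bar> \<le> k * \<bar>fst h \<bullet> v\<bar>" using nz by (simp add: field_simps)
        moreover have "- (s h * (fst h \<bullet> y)) \<le> \<bar>fst h \<bullet> y\<bar>"
          using s1[OF h] by (metis abs_ge_minus_self abs_mult mult_1)
        moreover have "s h * (fst h \<bullet> (y + k *\<^sub>R v)) = s h * (fst h \<bullet> y) + k * (s h * (fst h \<bullet> v))"
          by (simp add: inner_simps algebra_simps)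
        ultimately show ?thesis using eq by simp
      qed
    qed
    then have "y + k *\<^sub>R v \<in> ?W" using CW by blast
    then have "(y + k *\<^sub>R v) - k *\<^sub>R v \<in> ?W"
      using vW subspace_cflat[of v] by (intro subspace_diff subspace_scale)
    then have "y \<in> ?W" by simp
    then show "y = 0" using y by (auto simp: M_def)
  qed
  then obtain r where r: "r > 0" "\<And>q. q \<in> Q \<Longrightarrow> norm q \<le> r" by (auto simp: bounded_pos)
  have "infdist z ?W \<le> r" if z: "z \<in> cell I x" for z
  proof -
    obtain p q where pq: "p \<in> span ?W" "\<And>w. w \<in> span ?W \<Longrightarrow> orthogonal q w" "z = p + q"
      using orthogonal_subspace_decomp_exists[of ?W z] by metis
    have p: "p \<in> ?W" and q: "q \<in> M" using pq by (auto simp: spW M_def orthogonal_def inner_commute)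
    have "s h * (fst h \<bullet> q - snd h) \<ge> 0" if h: "h \<in> J" for h
    proof -
      have hI: "h \<in> I" "fst h \<bullet> v = 0" using h by (auto simp: J_def)
      then have "fst h \<bullet> p = 0" using p roots by (auto simp: cflat_def)
      then have "fst h \<bullet> q - snd h = fst h \<bullet> z - snd h" by (simp add: pq(3) inner_simps)
      moreover have "sgn (fst h \<bullet> z - snd h) = s h" using z hI(1) by (simp add: cell_def s_def)
      ultimately show ?thesis by (metis abs_ge_zero abs_sgn mult.commute)
    qed
    then have "q \<in> Q" using q by (simp add: Q_def)
    then have "norm q \<le> r" by (rule r)
    then show ?thesis
      using infdist_le[OF p, of z] by (simp add: pq(3) dist_norm)
  qed
  then show ?thesis using r(1) by blast
qed

text \<open>\<open>cflat v\<close> realises the bound. Any other admissible subspace contains the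
  recession cone, whose dimension is already \<open>card (mags v)\<close>.\<close>

lemma level_region:
  fixes I :: "((real^'n) \<times> real) set"
  assumes roots: "fst ` I = roots" and x: "x \<notin> \<Union>(hyp ` I)"
    and fin: "finite I" and v: "v \<in> rel_interior (rec_cone (cell I x))"
  shows "level (cell I x) = card (mags v)"
  unfolding level_def
proof (rule Least_equality)
  show "\<exists>W r. subspace W \<and> dim W = card (mags v) \<and> r > 0 \<and> cell I x \<subseteq> {z. infdist z W \<le> r}"
    using region_near_cflat[OF assms] subspace_cflat dim_cflat by blast
next
  fix l assume "\<exists>W r. subspace W \<and> dim W = l \<and> r > 0 \<and> cell I x \<subseteq> {z. infdist z W \<le> r}"
  then obtain W r where W: "subspace W" "dim W = l" "cell I x \<subseteq> {z. infdist z W \<le> r}" by blast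
  have "cell I x \<noteq> {}" using mem_cell_self by blast
  then have "rec_cone (cell I x) \<subseteq> W" by (rule rec_cone_subset_subspace[OF W(1) _ W(3)])
  then have "aff_dim (rec_cone (cell I x)) \<le> aff_dim W" by (rule aff_dim_subset)
  then show "card (mags v) \<le> l"
    using region_rec_cone(3)[OF assms] aff_dim_subspace[OF W(1)] W(2) by simp
qed

section \<open>The characteristic polynomial\<close>

lemma hyp_root_simps:
  "hyp (axis i 1, c) = {x. x$i = c}"
  "hyp (axis i 1 - axis j 1, c) = {x. x$i - x$j = c}"
  "hyp (axis i 1 + axis j 1, c) = {x. x$i + x$j = c}"
  by (simp_all add: hyp_def inner_diff_left inner_add_left inner_axis')

lemma hyp_eq_iff:
  assumes "\<alpha> \<noteq> 0" "hyp (\<alpha>, c) = hyp (\<alpha>, d)"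
  shows "c = d"
proof -
  have "(c / (\<alpha> \<bullet> \<alpha>)) *\<^sub>R \<alpha> \<in> hyp (\<alpha>, c)" using assms(1) by (simp add: hyp_def)
  then have "(c / (\<alpha> \<bullet> \<alpha>)) *\<^sub>R \<alpha> \<in> hyp (\<alpha>, d)" using assms(2) by simp
  then show ?thesis using assms(1) by (simp add: hyp_def)
qed

text \<open>\<open>I\<close> may contain several pairs for the same hyperplane, e.g. \<open>x$i - x$j = b\<close> and
  \<open>x$j - x$i = - b\<close>; this is harmless, and no normal vectors have to be chosen.\<close>

lemma nondeg_index_set:
  fixes B :: "(real^'n) set set"
  assumes B: "nondeg_B_deformation B"
  defines "I \<equiv> {h. fst h \<in> roots \<and> hyp h \<in> B}"
  shows "hyp ` I = B" "fst ` I = roots" "finite I"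
proof -
  have "\<exists>h\<in>I. H = hyp h" if H: "H \<in> B" for H
  proof -
    have "typeB_hyperplane H" using B H by (simp add: nondeg_B_deformation_def)
    then consider (1) i a where "H = {x. x$i = a}" | (2) i j b where "i \<noteq> j" "H = {x. x$i - x$j = b}"
      | (3) i j c where "i \<noteq> j" "H = {x. x$i + x$j = c}"
      unfolding typeB_hyperplane_def by blast
    then show ?thesis
    proof cases
      case 1
      then have "H = hyp (axis i 1, a)" by (simp add: hyp_root_simps)
      moreover have "axis i 1 \<in> (roots :: (real^'n) set)" by (auto simp: roots_def)
      ultimately show ?thesis using H by (auto simp: I_def)
    next
      case 2
      then have "H = hyp (axis i 1 - axis j 1, b)" by (simp add: hyp_root_simps)
      moreover have "axis i 1 - axis j 1 \<in> (roots :: (real^'n) set)" using 2 by (auto simp: roots_def)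
      ultimately show ?thesis using H by (auto simp: I_def)
    next
      case 3
      then have "H = hyp (axis i 1 + axis j 1, c)" by (simp add: hyp_root_simps)
      moreover have "axis i 1 + axis j 1 \<in> (roots :: (real^'n) set)" using 3 by (auto simp: roots_def)
      ultimately show ?thesis using H by (auto simp: I_def)
    qed
  qed
  then have "B \<subseteq> hyp ` I" by blast
  moreover have "hyp ` I \<subseteq> B" by (auto simp: I_def)
  ultimately show "hyp ` I = B" by blast
  have "\<forall>\<alpha>\<in>roots. \<exists>c. hyp (\<alpha>, c) \<in> B"
    unfolding ball_roots hyp_root_simps using B by (simp add: nondeg_B_deformation_def)
  then show "fst ` I = roots" by (force simp: I_def image_iff)
  \<comment> \<open>A nonzero normal and its hyperplane determine the offset, so \<open>I\<close>
    embeds into the finite set \<open>roots \<times> B\<close>.\<close>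
  have "inj_on (\<lambda>h. (fst h, hyp h)) I"
  proof (rule inj_onI)
    fix g h assume g: "g \<in> I" and eq: "(fst g, hyp g) = (fst h, hyp h)"
    have "fst g \<noteq> 0" using g zero_notin_roots by (auto simp: I_def)
    then have "snd g = snd h" using hyp_eq_iff[of "fst g" "snd g" "snd h"] eq by simp
    then show "g = h" using eq by (simp add: prod_eq_iff)
  qed
  moreover have "(\<lambda>h. (fst h, hyp h)) ` I \<subseteq> roots \<times> B" by (auto simp: I_def)
  moreover have "finite ((roots :: (real^'n) set) \<times> B)" using B by (simp add: nondeg_B_deformation_def finite_roots)
  ultimately show "finite I" by (meson finite_imageD finite_subset)
qed

lemma mags_card_le: "card (mags v) \<le> CARD('n)" for v :: "real^'n"
  using dim_subset_UNIV[of "cflat v"] by (simp add: dim_cflat)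

text \<open>A region is open, hence of full dimension, and its recession cone has dimension equal to
  the level. So \<open>psi\<close> is one fixed sign on a single Coxeter cell and 0 elsewhere, and
  the integer points of that cell are counted.\<close>

lemma sum_psi_region:
  fixes I :: "((real^'n) \<times> real) set"
  assumes roots: "fst ` I = roots" and fin: "finite I" and x: "x \<notin> \<Union>(hyp ` I)"
  shows "(\<Sum>v\<in>zbox m. psi v (cell I x)) =
    (-1) ^ (CARD('n) - level (cell I x)) * real (m choose level (cell I x))"
    and "level (cell I x) \<le> CARD('n)"
proof -
  let ?R = "cell I x"
  have conv: "convex (rec_cone ?R)" using fin by (intro convex_rec_cone rel_open_cell)
  then have "rel_interior (rec_cone ?R) \<noteq> {}"
    using rel_interior_eq_empty zero_in_rec_cone[of ?R] by blast
  then obtain w where w: "w \<in> rel_interior (rec_cone ?R)" by blast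
  note rc = region_rec_cone[OF roots x fin w]
  have lev: "level ?R = card (mags w)" by (rule level_region[OF roots x fin w])
  then show le: "level ?R \<le> CARD('n)" using mags_card_le by simp
  have "closed (\<Union>(hyp ` I))"
    using fin by (intro closed_Union) (auto simp: hyp_def closed_hyperplane)
  then have "open (UNIV - \<Union>(hyp ` I))" by (simp add: open_Diff)
  moreover have "?R \<in> components (UNIV - \<Union>(hyp ` I))"
    unfolding components_arrangement[OF fin] using x by blast
  ultimately have "open ?R" by (rule open_components)
  moreover have ne: "?R \<noteq> {}" using mem_cell_self by blast
  ultimately have "aff_dim ?R = int CARD('n)" by (simp add: aff_dim_open)
  then have "aff_dim ?R - aff_dim (rec_cone ?R) = int (CARD('n) - level ?R)"
    using rc(3) lev le by (simp add: of_nat_diff)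
  then have psi: "psi v ?R = (if v \<in> cell coxB w then (-1) ^ (CARD('n) - level ?R) else 0)" for v
    using ne by (simp only: psi_def rc(1) power_int_of_nat simp_thms)
  have "(\<Sum>v\<in>zbox m. psi v ?R) =
      (\<Sum>v\<in>{v\<in>zbox m. v \<in> cell coxB w}. (-1) ^ (CARD('n) - level ?R))"
    unfolding psi by (rule sum.inter_filter[OF finite_zbox, symmetric])
  also have "{v\<in>zbox m. v \<in> cell coxB w} = cell coxB w \<inter> zbox m" by blast
  finally show "(\<Sum>v\<in>zbox m. psi v ?R) = (-1) ^ (CARD('n) - level ?R) * real (m choose level ?R)"
    by (simp add: card_cell_zbox lev)
qed

text \<open>The powers of \<open>2 * m + 1\<close> count the integer vectors parallel to each flat.
  Summing \<open>psi_mobius_sum\<close> over the vectors in \<open>zbox m\<close> turns this count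
  into one over regions.\<close>

lemma char_poly_odd:
  fixes I :: "((real^'n) \<times> real) set"
  assumes roots: "fst ` I = roots" and fin: "finite I"
  shows "char_poly (hyp ` I) (2 * real m + 1) =
    (\<Sum>R\<in>regions (hyp ` I). (-1) ^ (CARD('n) - level R) * real (m choose level R))"
proof -
  let ?B = "hyp ` I"
  let ?L = "intersection_poset ?B" and ?mu = "arr_mobius ?B"
  have nz: "fst h \<noteq> 0" if "h \<in> I" for h using that roots zero_notin_roots by force
  have reg: "regions ?B = cell I ` (UNIV - \<Union>?B)"
    unfolding regions_def by (rule components_arrangement[OF fin])
  have pow: "(2 * real m + 1) ^ nat (aff_dim X) = (\<Sum>v\<in>zbox m. psi v X)" if X: "X \<in> ?L" for X
  proof -
    have "(\<Sum>v\<in>zbox m. psi v X) = (\<Sum>v\<in>zbox m. if v \<in> rec_cone X then 1 else 0)"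
      by (simp add: psi_affine[OF flat_affine[OF X] flat_nonempty[OF X]])
    also have "\<dots> = (\<Sum>v\<in>{v\<in>zbox m. v \<in> rec_cone X}. 1)"
      by (rule sum.inter_filter[OF finite_zbox, symmetric])
    also have "\<dots> = real (card {v\<in>zbox m. v \<in> rec_cone X})" by simp
    also have "{v\<in>zbox m. v \<in> rec_cone X} = rec_cone X \<inter> zbox m" by blast
    also have "card \<dots> = (2 * m + 1) ^ nat (aff_dim X)"
      by (rule card_rec_cone_flat_zbox[OF X]) (simp add: roots)
    finally show ?thesis by (simp add: algebra_simps)
  qed
  have "char_poly ?B (2 * real m + 1) = (\<Sum>X\<in>?L. \<Sum>v\<in>zbox m. ?mu X * psi v X)"
    unfolding char_poly_def by (intro sum.cong refl) (simp add: pow sum_distrib_left)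
  also have "\<dots> = (\<Sum>v\<in>zbox m. \<Sum>X\<in>?L. ?mu X * psi v X)" by (rule sum.swap)
  also have "\<dots> = (\<Sum>v\<in>zbox m. \<Sum>R\<in>regions ?B. psi v R)"
    unfolding reg by (intro sum.cong refl psi_mobius_sum[OF fin nz])
  also have "\<dots> = (\<Sum>R\<in>regions ?B. \<Sum>v\<in>zbox m. psi v R)" by (rule sum.swap)
  also have "\<dots> = (\<Sum>R\<in>regions ?B. (-1) ^ (CARD('n) - level R) * real (m choose level R))"
    unfolding reg by (intro sum.cong refl) (auto simp: sum_psi_region[OF roots fin])
  finally show ?thesis .
qed

text \<open>Each factor (t - 1)/2 - i of the falling factorial is linear in t.\<close>

lemma gbinomial_is_poly: "\<exists>q. \<forall>t::real. poly q t = ((t - 1) / 2) gchoose k"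
proof
  show "\<forall>t. poly (smult (1 / fact k) (\<Prod>i=0..<k. [:- 1/2 - real i, 1/2:])) t = ((t - 1) / 2) gchoose k"
    by (auto simp: poly_prod gbinomial_prod_rev intro!: prod.cong arg_cong[of _ _ "\<lambda>x. x / _"]
        simp: field_simps)
qed

lemma poly_fun_eqI:
  fixes p q :: "real poly"
  assumes "\<And>m::nat. poly p (2 * real m + 1) = poly q (2 * real m + 1)"
  shows "p = q"
proof (rule ccontr)
  assume "p \<noteq> q"
  then have "finite {t. poly (p - q) t = 0}" by (intro poly_roots_finite) simp
  moreover have "range (\<lambda>m::nat. 2 * real m + 1) \<subseteq> {t. poly (p - q) t = 0}"
    using assms by auto
  moreover have "infinite (range (\<lambda>m::nat. 2 * real m + 1))"
    by (rule range_inj_infinite) (simp add: inj_on_def)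
  ultimately show False using finite_subset by blast
qed

theorem theorem1p2:
  fixes B :: "(real^'n) set set"
  assumes "nondeg_B_deformation B"
  shows "\<forall>t::real. char_poly B t =
           (\<Sum>k=0..CARD('n). (-1) ^ (CARD('n) - k) *
              real (card {R\<in>regions B. level R = k}) * (((t - 1) / 2) gchoose k))"
proof -
  define I where "I = {h::(real^'n) \<times> real. fst h \<in> roots \<and> hyp h \<in> B}"
  note I = nondeg_index_set[OF assms, folded I_def]
  let ?L = "intersection_poset B" and ?n = "CARD('n)"
  obtain g :: "nat \<Rightarrow> real poly" where g: "\<And>k t. poly (g k) t = ((t - 1) / 2) gchoose k"
    using gbinomial_is_poly by metis
  define p where "p = (\<Sum>X\<in>?L. smult (arr_mobius B X) (monom 1 (nat (aff_dim X))))"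
  define q where "q = (\<Sum>k=0..?n. smult ((-1) ^ (?n - k) * real (card {R\<in>regions B. level R = k})) (g k))"
  have p: "poly p t = char_poly B t" for t
    by (simp add: p_def char_poly_def poly_sum poly_monom)
  have q: "poly q t = (\<Sum>k=0..?n. (-1) ^ (?n - k) *
              real (card {R\<in>regions B. level R = k}) * (((t - 1) / 2) gchoose k))" for t
    by (simp add: q_def poly_sum g)
  have reg: "regions B = cell I ` (UNIV - \<Union>B)"
    using components_arrangement[OF I(3)] by (simp add: regions_def I(1))
  have fin: "finite (regions B)"
    unfolding reg by (rule finite_subset[OF _ finite_cells[OF I(3)]]) blast
  have lev: "level ` regions B \<subseteq> {0..?n}"
    using sum_psi_region(2)[OF I(2,3)] by (auto simp: reg I(1))
  have "p = q"
  proof (rule poly_fun_eqI)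
    fix m :: nat
    let ?f = "\<lambda>R. (-1) ^ (?n - level R) * real (m choose level R)"
    have "poly p (2 * real m + 1) = (\<Sum>R\<in>regions B. ?f R)"
      unfolding p using char_poly_odd[OF I(2,3), of m] by (simp only: I(1))
    \<comment> \<open>Regions are grouped by level; by \<open>lev\<close> no level exceeds the
      dimension, so no region is lost.\<close>
    also have "\<dots> = (\<Sum>k=0..?n. \<Sum>R\<in>{R\<in>regions B. level R = k}. ?f R)"
      by (rule sum.group[OF fin _ lev, symmetric]) simp
    also have "\<dots> = (\<Sum>k=0..?n. (-1) ^ (?n - k) *
        real (card {R\<in>regions B. level R = k}) * (real m gchoose k))"
      by (intro sum.cong refl) (simp add: binomial_gbinomial)
    \<comment> \<open>At t = 2m + 1 the argument (t - 1)/2 of the binomials equals m.\<close>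
    also have "\<dots> = poly q (2 * real m + 1)" by (simp add: q)
    finally show "poly p (2 * real m + 1) = poly q (2 * real m + 1)" .
  qed
  then show ?thesis using p q by metis
qed

end
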